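(* Let $F$ be a non-archimedean local field of residue characteristic $p$ with residue field of cardinality $q=p^e$, let $G_S=\mathrm{SL}_2(F)$, $K_0=\mathrm{SL}_2(\mathcal{O}_F)$, let $\vec r\in\{0,\dots,p-1\}^e$, let $\tau$ be the standard Hecke operator on $\mathrm{ind}_{K_0}^{G_S}(\sigma_{\vec r})$, and let $(f_n)_{n\in\mathbb{Z}}$ be the basis of $\mathrm{ind}_{K_0}^{G_S}(\sigma_{\vec r})^{I_S(1)}$ defined in the context. Then: (i) $\tau(f_0)=f_{-1}+\lambda_{\sigma_{\vec r}}f_1$, where $\lambda_{\sigma_{\vec r}}=0$ if $\vec r\neq\vec 0$ and $\lambda_{\sigma_{\vec r}}=1$ if $\vec r=\vec 0$. (ii) For every $n\ne0$ there is a scalar $c_n\in\bar{\mathbb{F}}_p$ such that $\tau(f_n)=c_nf_n+f_{n+\delta(n)}$, where $\delta(n)=1$ if $n>0$ and $\delta(n)=-1$ if $n<0$.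
   Context: $\bar{\mathbb{F}}_p$ is a fixed algebraic closure of $\mathbb{F}_p$; all representations are over $\bar{\mathbb{F}}_p$. $\mathcal{O}_F$ is the valuation ring of $F$, $\mathfrak{p}_F$ its maximal ideal, $\varpi_F$ a fixed uniformizer, $k_F=\mathcal{O}_F/\mathfrak{p}_F=\mathbb{F}_q$ with a fixed embedding in $\bar{\mathbb{F}}_p$, and $[\cdot]:k_F\to\mathcal{O}_F$ the Teichmüller lift. Weights: for $\vec r=(r_0,\dots,r_{e-1})\in\{0,\dots,p-1\}^e$, $\sigma_{\vec r}:=\mathrm{Sym}^{r_0}\bar{\mathbb{F}}_p^2\otimes\cdots\otimes\mathrm{Sym}^{r_{e-1}}\bar{\mathbb{F}}_p^2$, where $\mathrm{Sym}^{r_i}\bar{\mathbb{F}}_p^2=\bigoplus_{l=0}^{r_i}\bar{\mathbb{F}}_pX^{r_i-l}Y^l$ and $\begin{pmatrix}a&b\\c&d\end{pmatrix}\in\mathrm{SL}_2(\mathbb{F}_q)$ acts on the $i$-th factor by $X^{r_i-l}Y^l\mapsto(a^{p^i}X+c^{p^i}Y)^{r_i-l}(b^{p^i}X+d^{p^i}Y)^l$; $K_0$ acts through reduction $K_0\to\mathrm{SL}_2(\mathbb{F}_q)$. Put $v_{\sigma_{\vec r}}=X^{r_0}\otimes\cdots\otimes X^{r_{e-1}}$. Compact induction: $\mathrm{ind}_{K_0}^{G_S}(\sigma_{\vec r})$ is the space of functions $f:G_S\to\sigma_{\vec r}$ with $f(kg)=\sigma_{\vec r}(k)f(g)$ for $k\in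 K_0$, $g\in G_S$, and support a finite union of cosets $K_0g$; $G_S$ acts by $(g\cdot f)(g')=f(g'g)$. For $g\in G_S$, $v\in\sigma_{\vec r}$, the standard function $[g,v]$ is given by $[g,v](x)=\sigma_{\vec r}(xg)v$ if $x\in K_0g^{-1}$ and $0$ otherwise; these span the compact induction. Let $\alpha_0=\mathrm{diag}(\varpi_F^{-1},\varpi_F)$, $w_0=\begin{pmatrix}0&-1\\1&0\end{pmatrix}$, and $I_S(1)=\begin{pmatrix}1+\mathfrak{p}_F&\mathcal{O}_F\\\mathfrak{p}_F&1+\mathfrak{p}_F\end{pmatrix}\cap K_0$ (the pro-$p$-Iwahori subgroup). $U_S(\mathfrak{p}_F^n)$ (resp. $\bar U_S(\mathfrak{p}_F^n)$) is the group of upper (resp. lower) unipotent matrices in $G_S$ with top right (resp. bottom left) entry in $\mathfrak{p}_F^n$; $U_S(\mathcal{O}_F)=U_S(\mathfrak{p}_F^0)$. For $\lambda=(\lambda_0,\dots,\lambda_{m-1})\in k_F^m$ put $A(\lambda)=\sum_{j=0}^{m-1}[\lambda_j]\varpi_F^j$. Let $U_{\vec r}=U_{r_0}\otimes\cdots\otimes U_{r_{e-1}}\in\mathrm{End}_{\bar{\mathbb{F}}_p}(\sigma_{\vec r})$, where $U_{r_j}(X^lY^{r_j-l})=Y^{r_j}$ if $l=0$ and $0$ if $l\ne0$. Hecke operator: $\tau$ is the $G_S$-equivariant endomorphism of $\mathrm{ind}_{K_0}^{G_S}(\sigma_{\vec r})$ (a generator of the polynomial algebra $\mathrm{End}_{G_S}(\mathrm{ind}_{K_0}^{G_S}(\sigma_{\vec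 r}))=\bar{\mathbb{F}}_p[\tau]$) given by $$\tau([g,v])=\sum_{\lambda\in k_F^2}\Big[g\begin{pmatrix}1&A(\lambda)\\0&1\end{pmatrix}\alpha_0^{-1},\,w_0U_{\vec r}\,\sigma_{\vec r}\Big(\begin{pmatrix}0&1\\-1&A(\lambda)\end{pmatrix}\Big)v\Big]+\sum_{\mu\in k_F}\Big[g\begin{pmatrix}1&0\\\varpi_FA(\mu)&1\end{pmatrix}\alpha_0,\,U_{\vec r}v\Big].$$ Invariants: $f_n$ ($n\in\mathbb{Z}$) is the $I_S(1)$-invariant function in $\mathrm{ind}_{K_0}^{G_S}(\sigma_{\vec r})$ supported on $K_0\alpha_0^{-n}I_S(1)$ with $f_n(\alpha_0^{-n})=w_0\cdot v_{\sigma_{\vec r}}$ if $n>0$ and $f_n(\alpha_0^{-n})=v_{\sigma_{\vec r}}$ if $n\le0$. Explicitly, $f_n=\sum_{\bar u\in\bar U_S(\mathfrak{p}_F)/\bar U_S(\mathfrak{p}_F^{2n})}[\bar u\alpha_0^n,w_0\cdot v_{\sigma_{\vec r}}]$ for $n>0$ and $f_n=\sum_{u\in U_S(\mathcal{O}_F)/U_S(\mathfrak{p}_F^{-2n})}[u\alpha_0^n,v_{\sigma_{\vec r}}]$ for $n\le0$. The $f_n$ form a basis of the space of $I_S(1)$-invariants. *)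

theory Defs
  imports
    "HOL-Analysis.Analysis"
    "HOL-Algebra.Algebraic_Closure_Type"
    "HOL-Library.Function_Algebras"
begin

section \<open>Local fields\<close>

text \<open>
  The valuation \<open>v\<close> is only meaningful on nonzero elements; \<open>v 0\<close> is never used.
  \<open>val_ideal v n\<close> is the \<open>n\<close>-th power of the maximal ideal, so \<open>val_ideal v 0\<close> is the
  valuation ring.
\<close>

definition val_ideal :: "('f::field \<Rightarrow> int) \<Rightarrow> int \<Rightarrow> 'f set" where
  "val_ideal v n = {x. x = 0 \<or> n \<le> v x}"

definition valuation_ring :: "('f::field \<Rightarrow> int) \<Rightarrow> 'f ring" where
  "valuation_ring v = (ring_of_type_algebra :: 'f ring) \<lparr>carrier := val_ideal v 0\<rparr>"

definition residue_field :: "('f::field \<Rightarrow> int) \<Rightarrow> 'f set ring" where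
  "residue_field v = valuation_ring v Quot val_ideal v 1"

definition residue_class :: "('f::field \<Rightarrow> int) \<Rightarrow> 'f \<Rightarrow> 'f set" where
  "residue_class v x = val_ideal v 1 +>\<^bsub>valuation_ring v\<^esub> x"

definition discrete_valuation :: "('f::field \<Rightarrow> int) \<Rightarrow> bool" where
  "discrete_valuation v \<longleftrightarrow>
     (\<forall>x y. x \<noteq> 0 \<longrightarrow> y \<noteq> 0 \<longrightarrow> v (x * y) = v x + v y) \<and>
     (\<forall>x y. x \<noteq> 0 \<longrightarrow> y \<noteq> 0 \<longrightarrow> x + y \<noteq> 0 \<longrightarrow> min (v x) (v y) \<le> v (x + y)) \<and>
     v ` (- {0}) = UNIV"

definition valuation_complete :: "('f::field \<Rightarrow> int) \<Rightarrow> bool" where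
  "valuation_complete v \<longleftrightarrow>
     (\<forall>s :: nat \<Rightarrow> 'f.
        (\<forall>n. \<exists>M. \<forall>i\<ge>M. \<forall>j\<ge>M. s i - s j \<in> val_ideal v n) \<longrightarrow>
        (\<exists>x. \<forall>n. \<exists>M. \<forall>i\<ge>M. s i - x \<in> val_ideal v n))"

definition nonarch_local_field :: "('f::field \<Rightarrow> int) \<Rightarrow> bool" where
  "nonarch_local_field v \<longleftrightarrow>
     discrete_valuation v \<and> valuation_complete v \<and> finite (carrier (residue_field v))"

definition uniformizer :: "('f::field \<Rightarrow> int) \<Rightarrow> 'f \<Rightarrow> bool" where
  "uniformizer v \<pi> \<longleftrightarrow> \<pi> \<noteq> 0 \<and> v \<pi> = 1"

text \<open>The Teichmueller lift of a residue class \<open>c\<close> is the unique element of \<open>c\<close> fixed by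
  \<open>x \<mapsto> x ^ q\<close>, where \<open>q\<close> is the cardinality of the residue field.\<close>

definition teichmueller :: "('f::field \<Rightarrow> int) \<Rightarrow> 'f set \<Rightarrow> 'f" where
  "teichmueller v c = (THE x. x \<in> c \<and> x ^ card (carrier (residue_field v)) = x)"

definition teich_sum :: "('f::field \<Rightarrow> int) \<Rightarrow> 'f \<Rightarrow> 'f set list \<Rightarrow> 'f" where
  "teich_sum v \<pi> ls = (\<Sum>j<length ls. teichmueller v (ls ! j) * \<pi> ^ j)"

text \<open>The type \<open>'k\<close> is an algebraic closure of the field with \<open>p\<close> elements. Algebraic closedness is
  the sort constraint; in characteristic \<open>p\<close> the set \<open>\<int>\<close> is the prime field.\<close>

definition is_Fp_closure :: "'k::alg_closed_field itself \<Rightarrow> nat \<Rightarrow> bool" where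
  "is_Fp_closure _ p \<longleftrightarrow> CHAR('k) = p \<and>
     (\<forall>x::'k. \<exists>P. P \<noteq> 0 \<and> (\<forall>i. poly.coeff P i \<in> \<int>) \<and> poly P x = 0)"


section \<open>Subgroups and elements of \<open>SL\<^sub>2\<close>\<close>

definition mat2 :: "'a::zero \<Rightarrow> 'a \<Rightarrow> 'a \<Rightarrow> 'a \<Rightarrow> 'a ^ 2 ^ 2" where
  "mat2 a b c d = (\<chi> i j. if i = 1 then (if j = 1 then a else b) else (if j = 1 then c else d))"

definition SL2 :: "('f::field ^ 2 ^ 2) monoid" where
  "SL2 = \<lparr>carrier = {g. det g = 1}, mult = (**), one = mat 1\<rparr>"

definition K0 :: "('f::field \<Rightarrow> int) \<Rightarrow> ('f ^ 2 ^ 2) set" where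
  "K0 v = {g \<in> carrier SL2. \<forall>i j. g $ i $ j \<in> val_ideal v 0}"

definition IS1 :: "('f::field \<Rightarrow> int) \<Rightarrow> ('f ^ 2 ^ 2) set" where
  "IS1 v = {g \<in> K0 v. g $ 1 $ 1 - 1 \<in> val_ideal v 1 \<and> g $ 1 $ 2 \<in> val_ideal v 0 \<and>
                      g $ 2 $ 1 \<in> val_ideal v 1 \<and> g $ 2 $ 2 - 1 \<in> val_ideal v 1}"

definition alpha0 :: "'f::field \<Rightarrow> 'f ^ 2 ^ 2" where
  "alpha0 \<pi> = mat2 (inverse \<pi>) 0 0 \<pi>"

definition w0 :: "'f::field ^ 2 ^ 2" where
  "w0 = mat2 0 (- 1) 1 0"


section \<open>Weights\<close>

text \<open>
  The vector with coordinates \<open>x\<close> is the sum over all multi-indices \<open>l\<close> of \<open>x l\<close> times the tensor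
  product over \<open>i < e\<close> of \<open>X^(r i - l i) Y^(l i)\<close>. So \<open>l i\<close> is the exponent of \<open>Y\<close> in
  the \<open>i\<close>-th factor, and the weight is the space of coordinate functions supported on the
  multi-indices. Only the values \<open>r i\<close> with \<open>i < e\<close> matter.
\<close>

type_synonym 'k wt = "(nat \<Rightarrow> nat) \<Rightarrow> 'k"

definition multi_indices :: "nat \<Rightarrow> (nat \<Rightarrow> nat) \<Rightarrow> (nat \<Rightarrow> nat) set" where
  "multi_indices e r = (\<Pi>\<^sub>E i\<in>{..<e}. {..r i})"

definition weight :: "nat \<Rightarrow> (nat \<Rightarrow> nat) \<Rightarrow> 'k::field wt set" where
  "weight e r = {x. \<forall>l. l \<notin> multi_indices e r \<longrightarrow> x l = 0}"

definition pure_tensor :: "nat \<Rightarrow> (nat \<Rightarrow> nat) \<Rightarrow> (nat \<Rightarrow> nat \<Rightarrow> 'k::field) \<Rightarrow> 'k wt" where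
  "pure_tensor e r x = (\<lambda>l. if l \<in> multi_indices e r then \<Prod>i<e. x i (l i) else 0)"

text \<open>The tensor product of endomorphisms of the factors, where \<open>T i m l\<close> is the coefficient of
  \<open>X^(r i - m) Y^m\<close> in the image of \<open>X^(r i - l) Y^l\<close> under the \<open>i\<close>-th endomorphism.\<close>

definition tensor_map ::
  "nat \<Rightarrow> (nat \<Rightarrow> nat) \<Rightarrow> (nat \<Rightarrow> nat \<Rightarrow> nat \<Rightarrow> 'k::field) \<Rightarrow> 'k wt \<Rightarrow> 'k wt" where
  "tensor_map e r T x =
     (\<lambda>m. if m \<in> multi_indices e r
          then \<Sum>l\<in>multi_indices e r. (\<Prod>i<e. T i (m i) (l i)) * x l else 0)"

text \<open>The coefficient of \<open>X^(n - m) Y^m\<close> in the binary form \<open>(aX + cY)^(n - l) (bX + dY)^l\<close> is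
  computed after setting \<open>X = 1\<close>.\<close>

definition sym_coeff :: "nat \<Rightarrow> 'k::field ^ 2 ^ 2 \<Rightarrow> nat \<Rightarrow> nat \<Rightarrow> 'k" where
  "sym_coeff n A m l =
     poly.coeff ([:A $ 1 $ 1, A $ 2 $ 1:] ^ (n - l) * [:A $ 1 $ 2, A $ 2 $ 2:] ^ l) m"

text \<open>The residue field acts through a fixed embedding \<open>\<iota>\<close> into \<open>'k\<close>.\<close>

definition reduce ::
  "('f::field \<Rightarrow> int) \<Rightarrow> ('f set \<Rightarrow> 'k::field) \<Rightarrow> 'f ^ 2 ^ 2 \<Rightarrow> 'k ^ 2 ^ 2" where
  "reduce v \<iota> g = (\<chi> i j. \<iota> (residue_class v (g $ i $ j)))"

definition weight_act ::
  "('f::field \<Rightarrow> int) \<Rightarrow> ('f set \<Rightarrow> 'k::field) \<Rightarrow> nat \<Rightarrow> nat \<Rightarrow> (nat \<Rightarrow> nat) \<Rightarrow>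
     'f ^ 2 ^ 2 \<Rightarrow> 'k wt \<Rightarrow> 'k wt" where
  "weight_act v \<iota> p e r k =
     tensor_map e r (\<lambda>i. sym_coeff (r i) (\<chi> a b. (reduce v \<iota> k $ a $ b) ^ (p ^ i)))"

definition weight_vec :: "nat \<Rightarrow> (nat \<Rightarrow> nat) \<Rightarrow> 'k::field wt" where
  "weight_vec e r = pure_tensor e r (\<lambda>i l. if l = 0 then 1 else 0)"

text \<open>\<open>U\<close> fixes \<open>Y^(r i)\<close> and kills all other monomials in each factor.\<close>

definition U_op :: "nat \<Rightarrow> (nat \<Rightarrow> nat) \<Rightarrow> 'k::field wt \<Rightarrow> 'k wt" where
  "U_op e r = tensor_map e r (\<lambda>i m l. if l = r i \<and> m = r i then 1 else 0)"


section \<open>Compact induction and the Hecke operator\<close>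

text \<open>Functions on \<open>SL\<^sub>2\<close> are extended by \<open>0\<close> to all matrices. They are added pointwise.\<close>

type_synonym ('f, 'k) ifun = "'f ^ 2 ^ 2 \<Rightarrow> 'k wt"

definition scale :: "'k::field \<Rightarrow> ('f, 'k) ifun \<Rightarrow> ('f, 'k) ifun" where
  "scale c f = (\<lambda>g l. c * f g l)"

definition cind ::
  "('f::field \<Rightarrow> int) \<Rightarrow> ('f set \<Rightarrow> 'k::field) \<Rightarrow> nat \<Rightarrow> nat \<Rightarrow> (nat \<Rightarrow> nat) \<Rightarrow>
     ('f, 'k) ifun set" where
  "cind v \<iota> p e r =
     {f. (\<forall>g. g \<notin> carrier SL2 \<longrightarrow> f g = 0) \<and>
         (\<forall>g\<in>carrier SL2. f g \<in> weight e r) \<and>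
         (\<forall>k\<in>K0 v. \<forall>g\<in>carrier SL2. f (k ** g) = weight_act v \<iota> p e r k (f g)) \<and>
         (\<exists>S. finite S \<and> S \<subseteq> carrier SL2 \<and> {g. f g \<noteq> 0} = (\<Union>g\<in>S. K0 v #>\<^bsub>SL2\<^esub> g))}"

definition translate :: "'f::field ^ 2 ^ 2 \<Rightarrow> ('f, 'k) ifun \<Rightarrow> ('f, 'k) ifun" where
  "translate g f = (\<lambda>x. f (x ** g))"

definition std_fun ::
  "('f::field \<Rightarrow> int) \<Rightarrow> ('f set \<Rightarrow> 'k::field) \<Rightarrow> nat \<Rightarrow> nat \<Rightarrow> (nat \<Rightarrow> nat) \<Rightarrow>
     'f ^ 2 ^ 2 \<Rightarrow> 'k wt \<Rightarrow> ('f, 'k) ifun" where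
  "std_fun v \<iota> p e r g x =
     (\<lambda>h. if h \<in> K0 v #>\<^bsub>SL2\<^esub> (inv\<^bsub>SL2\<^esub> g) then weight_act v \<iota> p e r (h ** g) x else 0)"

definition is_hecke_op ::
  "('f::field \<Rightarrow> int) \<Rightarrow> 'f \<Rightarrow> ('f set \<Rightarrow> 'k::field) \<Rightarrow> nat \<Rightarrow> nat \<Rightarrow> (nat \<Rightarrow> nat) \<Rightarrow>
     (('f, 'k) ifun \<Rightarrow> ('f, 'k) ifun) \<Rightarrow> bool" where
  "is_hecke_op v \<pi> \<iota> p e r \<tau> \<longleftrightarrow>
     (\<forall>f\<in>cind v \<iota> p e r. \<tau> f \<in> cind v \<iota> p e r) \<and>
     (\<forall>f\<in>cind v \<iota> p e r. \<forall>f'\<in>cind v \<iota> p e r. \<tau> (f + f') = \<tau> f + \<tau> f') \<and>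
     (\<forall>c. \<forall>f\<in>cind v \<iota> p e r. \<tau> (scale c f) = scale c (\<tau> f)) \<and>
     (\<forall>g\<in>carrier SL2. \<forall>f\<in>cind v \<iota> p e r. \<tau> (translate g f) = translate g (\<tau> f)) \<and>
     (\<forall>g\<in>carrier SL2. \<forall>x\<in>weight e r.
        \<tau> (std_fun v \<iota> p e r g x) =
          (\<Sum>ls\<in>{ls. set ls \<subseteq> carrier (residue_field v) \<and> length ls = 2}.
             std_fun v \<iota> p e r
               (g ** mat2 1 (teich_sum v \<pi> ls) 0 1 ** (inv\<^bsub>SL2\<^esub> (alpha0 \<pi>)))
               (weight_act v \<iota> p e r w0
                  (U_op e r (weight_act v \<iota> p e r (mat2 0 1 (- 1) (teich_sum v \<pi> ls)) x)))) +
          (\<Sum>m\<in>carrier (residue_field v).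
             std_fun v \<iota> p e r
               (g ** mat2 1 0 (\<pi> * teich_sum v \<pi> [m]) 1 ** alpha0 \<pi>)
               (U_op e r x)))"

text \<open>The invariant function \<open>f\<^sub>n\<close>; its support condition and its value at one point determine it.\<close>

definition inv_fun ::
  "('f::field \<Rightarrow> int) \<Rightarrow> 'f \<Rightarrow> ('f set \<Rightarrow> 'k::field) \<Rightarrow> nat \<Rightarrow> nat \<Rightarrow> (nat \<Rightarrow> nat) \<Rightarrow>
     int \<Rightarrow> ('f, 'k) ifun" where
  "inv_fun v \<pi> \<iota> p e r n =
     (THE f. f \<in> cind v \<iota> p e r \<and>
        (\<forall>g\<in>IS1 v. translate g f = f) \<and>
        {x. f x \<noteq> 0} \<subseteq> {k ** (alpha0 \<pi> [^]\<^bsub>SL2\<^esub> (- n)) ** g | k g. k \<in> K0 v \<and> g \<in> IS1 v} \<and>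
        f (alpha0 \<pi> [^]\<^bsub>SL2\<^esub> (- n)) =
          (if n > 0 then weight_act v \<iota> p e r w0 (weight_vec e r) else weight_vec e r))"

end

theory Submission
  imports Defs
begin

text \<open>
  A function \<open>f\<^sub>n\<close> is a sum of standard functions \<open>[u \<alpha>\<^sup>n, x]\<close>, where \<open>u\<close> runs over unipotent matrices
  that represent \<open>\<o> / \<p>\<^sup>-\<^sup>2\<^sup>n\<close> (upper triangular, \<open>x\<close> the highest weight vector \<open>X\<close>) for \<open>n \<le> 0\<close>, and
  \<open>\<p> / \<p>\<^sup>2\<^sup>n\<close> (lower triangular, \<open>x\<close> the lowest weight vector \<open>Y\<close>) for \<open>n > 0\<close>; here
  \<open>\<alpha> = diag(1/\<pi>, \<pi>)\<close>. Its defining properties hold because the pro-\<open>p\<close> Iwahori subgroup permutes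
  these cosets by fractional linear maps that are isometries (\<open>sum_transversal_moebius\<close>), while the
  correction factors in \<open>K\<^sub>0\<close> fix \<open>x\<close> (\<open>inv_fun_nonpos\<close>, \<open>inv_fun_pos\<close>).

  The Hecke operator sends \<open>[g, x]\<close> to a sum over digits \<open>A\<close> modulo \<open>\<pi>\<^sup>2\<close> (first family, upper
  triangular) plus a sum over digits \<open>B\<close> modulo \<open>\<pi>\<close> (second family, lower triangular). A standard
  function only depends on \<open>(g, x)\<close> up to \<open>K\<^sub>0\<close>, so every term is rewritten by a matrix identity. In
  terms of the tree of \<open>SL\<^sub>2\<close>, each term takes the vertex of \<open>u \<alpha>\<^sup>n\<close> a step ahead, leaves the level
  unchanged, or goes a step back.

  \<^item> For \<open>n \<le> 0\<close> the first family fixes \<open>X\<close> and refines the coset of \<open>u\<close> by two digits: it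
  contributes \<open>f\<^sub>n\<^sub>-\<^sub>1\<close>. The second family carries \<open>U X\<close>, which is \<open>0\<close> unless the weight is trivial.
  For the trivial weight and \<open>n < 0\<close> the digit \<open>0\<close> goes back, and the other \<open>q - 1\<close> digits stay at the
  same level and contribute \<open>f\<^sub>n\<close> each. For \<open>n = 0\<close> the second family is \<open>f\<^sub>1\<close> itself.

  \<^item> For \<open>n > 0\<close> the second family contributes the cosets of \<open>f\<^sub>n\<^sub>+\<^sub>1\<close> whose new digits are divisible
  by \<open>\<pi>\<close>. The unit digits \<open>A\<close> of the first family contribute, through \<open>1 / A\<close>, exactly the missing
  ones; the scalar by which they act on the weight cancels (\<open>first_sum_lower_unit\<close>). The digits \<open>A\<close> in
  \<open>\<p>\<close> are killed by the weight unless it is trivial, and then they go back or stay as before.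

  Terms that go back are constant on larger cosets than those that \<open>u\<close> represents, so that each value
  occurs a multiple of \<open>q\<close> times and the sum vanishes in characteristic \<open>p\<close> (\<open>sum_transversal_vanishes\<close>).
  Hence \<open>c\<^sub>n\<close> is \<open>q - 1\<close>, that is \<open>-1\<close>, for the trivial weight and \<open>0\<close> for all others.
\<close>

section \<open>Discrete valuations and representatives of quotients of ideals\<close>

locale discretely_valued =
  fixes v :: "'f::field \<Rightarrow> int"
  assumes discrete_valuation: "discrete_valuation v"
begin

lemma val_mult: "x \<noteq> 0 \<Longrightarrow> y \<noteq> 0 \<Longrightarrow> v (x * y) = v x + v y"
  using discrete_valuation by (auto simp: discrete_valuation_def)

lemma val_add: "x \<noteq> 0 \<Longrightarrow> y \<noteq> 0 \<Longrightarrow> x + y \<noteq> 0 \<Longrightarrow> min (v x) (v y) \<le> v (x + y)"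
  using discrete_valuation by (auto simp: discrete_valuation_def)

lemma val_one [simp]: "v 1 = 0"
  using val_mult[of 1 1] by simp

lemma val_minus [simp]: "v (- x) = v x"
proof (cases "x = 0")
  case False
  have "v (- 1) + v (- 1) = 0"
    using val_mult[of "- 1" "- 1"] by simp
  with False show ?thesis
    using val_mult[of "- 1" x] by simp
qed auto

lemma val_inverse: "x \<noteq> 0 \<Longrightarrow> v (inverse x) = - v x"
  using val_mult[of x "inverse x"] by simp

lemma val_divide: "x \<noteq> 0 \<Longrightarrow> y \<noteq> 0 \<Longrightarrow> v (x / y) = v x - v y"
  by (simp add: divide_inverse val_mult val_inverse)

lemma val_power: "x \<noteq> 0 \<Longrightarrow> v (x ^ n) = int n * v x"
  by (induction n) (auto simp: val_mult algebra_simps)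

lemma val_power_int: "x \<noteq> 0 \<Longrightarrow> v (x powi n) = n * v x"
  by (cases "n \<ge> 0") (auto simp: power_int_def val_power val_inverse)

lemma zero_in_ideal [simp]: "0 \<in> val_ideal v n"
  by (simp add: val_ideal_def)

lemma in_ideal_iff: "x \<noteq> 0 \<Longrightarrow> x \<in> val_ideal v n \<longleftrightarrow> n \<le> v x"
  by (simp add: val_ideal_def)

lemma ideal_add: "x \<in> val_ideal v n \<Longrightarrow> y \<in> val_ideal v n \<Longrightarrow> x + y \<in> val_ideal v n"
  using val_add[of x y] by (cases "x = 0 \<or> y = 0 \<or> x + y = 0") (auto simp: val_ideal_def)

lemma ideal_minus_iff [simp]: "- x \<in> val_ideal v n \<longleftrightarrow> x \<in> val_ideal v n"
  by (auto simp: val_ideal_def)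

lemma ideal_diff: "x \<in> val_ideal v n \<Longrightarrow> y \<in> val_ideal v n \<Longrightarrow> x - y \<in> val_ideal v n"
  using ideal_add[of x n "- y"] by simp

lemma ideal_diff_commute: "x - y \<in> val_ideal v n \<longleftrightarrow> y - x \<in> val_ideal v n"
  using ideal_minus_iff[of "x - y" n] by simp

lemma ideal_mono: "x \<in> val_ideal v n \<Longrightarrow> m \<le> n \<Longrightarrow> x \<in> val_ideal v m"
  by (auto simp: val_ideal_def)

lemma ideal_mult: "x \<in> val_ideal v m \<Longrightarrow> y \<in> val_ideal v n \<Longrightarrow> x * y \<in> val_ideal v (m + n)"
  by (cases "x = 0 \<or> y = 0") (auto simp: val_ideal_def val_mult)

lemma ideal_mult_0: "x \<in> val_ideal v 0 \<Longrightarrow> y \<in> val_ideal v n \<Longrightarrow> x * y \<in> val_ideal v n"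
  using ideal_mult[of x 0 y n] by simp

lemma ideal_mult_0': "x \<in> val_ideal v n \<Longrightarrow> y \<in> val_ideal v 0 \<Longrightarrow> x * y \<in> val_ideal v n"
  using ideal_mult[of x n y 0] by simp

lemma one_in_ideal_0 [simp]: "1 \<in> val_ideal v 0"
  by (simp add: val_ideal_def)

lemma one_notin_ideal_1 [simp]: "1 \<notin> val_ideal v 1"
  by (simp add: val_ideal_def)

lemma ideal_power_0: "x \<in> val_ideal v 0 \<Longrightarrow> x ^ n \<in> val_ideal v 0"
  by (induction n) (auto intro: ideal_mult_0)

lemma ideal_scale_iff: "s \<noteq> 0 \<Longrightarrow> s * x \<in> val_ideal v n \<longleftrightarrow> x \<in> val_ideal v (n - v s)"
  by (cases "x = 0") (auto simp: val_ideal_def val_mult)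

lemma unit_val: "x \<in> val_ideal v 0 \<Longrightarrow> x \<notin> val_ideal v 1 \<Longrightarrow> x \<noteq> 0 \<and> v x = 0"
  by (auto simp: val_ideal_def)

lemma one_unit:
  assumes "x - 1 \<in> val_ideal v 1"
  shows "x \<in> val_ideal v 0" "x \<notin> val_ideal v 1" "x \<noteq> 0" "v x = 0"
proof -
  show "x \<in> val_ideal v 0"
    using ideal_add[of "x - 1" 0 1] ideal_mono[OF assms, of 0] by simp
  show "x \<notin> val_ideal v 1"
    using ideal_diff[OF _ assms, of x] by auto
  then show "x \<noteq> 0" "v x = 0"
    using unit_val \<open>x \<in> val_ideal v 0\<close> by auto
qed

lemma in_all_ideals_imp_zero:
  assumes "\<And>n::nat. x \<in> val_ideal v (int n)"
  shows "x = 0"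
proof (rule ccontr)
  assume "x \<noteq> 0"
  then show False
    using assms[of "nat (v x + 1)"] by (auto simp: in_ideal_iff split: if_splits)
qed

text \<open>Sums over \<open>\<p>\<^sup>a / \<p>\<^sup>b\<close> are written as sums over a set of representatives; periodicity of the summand
  makes the choice immaterial.\<close>

definition transversal :: "int \<Rightarrow> int \<Rightarrow> 'f set \<Rightarrow> bool" where
  "transversal a b R \<longleftrightarrow> finite R \<and> R \<subseteq> val_ideal v a \<and>
     (\<forall>x\<in>val_ideal v a. \<exists>!y\<in>R. x - y \<in> val_ideal v b)"

definition periodic :: "int \<Rightarrow> int \<Rightarrow> ('f \<Rightarrow> 'm) \<Rightarrow> bool" where
  "periodic a b F \<longleftrightarrow>
     (\<forall>x\<in>val_ideal v a. \<forall>y\<in>val_ideal v a. x - y \<in> val_ideal v b \<longrightarrow> F x = F y)"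

lemma periodicD:
  "periodic a b F \<Longrightarrow> x \<in> val_ideal v a \<Longrightarrow> y \<in> val_ideal v a \<Longrightarrow>
    x - y \<in> val_ideal v b \<Longrightarrow> F x = F y"
  unfolding periodic_def by blast

lemma transversal_finite: "transversal a b R \<Longrightarrow> finite R"
  and transversal_subset: "transversal a b R \<Longrightarrow> R \<subseteq> val_ideal v a"
  by (simp_all add: transversal_def)

lemma transversal_ex1:
  "transversal a b R \<Longrightarrow> x \<in> val_ideal v a \<Longrightarrow> \<exists>!y. y \<in> R \<and> x - y \<in> val_ideal v b"
  by (simp add: transversal_def)

lemma transversal_eqI:
  assumes "transversal a b R" "x \<in> R" "y \<in> R" "x - y \<in> val_ideal v b"
  shows "x = y"
proof -
  have "x \<in> val_ideal v a"
    using assms transversal_subset by blast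
  then have "\<exists>!z. z \<in> R \<and> x - z \<in> val_ideal v b"
    using assms(1) transversal_ex1 by blast
  moreover have "x - x \<in> val_ideal v b"
    by simp
  ultimately show ?thesis
    using assms by blast
qed

lemma transversal_ex:
  assumes "transversal a b R" "x \<in> val_ideal v a"
  obtains y where "y \<in> R" "x - y \<in> val_ideal v b"
  using transversal_ex1[OF assms] by blast

lemma transversalI:
  assumes "finite R" "R \<subseteq> val_ideal v a"
    and "\<And>x. x \<in> val_ideal v a \<Longrightarrow> \<exists>y\<in>R. x - y \<in> val_ideal v b"
    and "\<And>x y. x \<in> R \<Longrightarrow> y \<in> R \<Longrightarrow> x - y \<in> val_ideal v b \<Longrightarrow> x = y"
  shows "transversal a b R"
  unfolding transversal_def
proof (intro conjI ballI assms(1,2))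
  fix x assume "x \<in> val_ideal v a"
  then obtain y where y: "y \<in> R" "x - y \<in> val_ideal v b"
    using assms(3) by blast
  show "\<exists>!y\<in>R. x - y \<in> val_ideal v b"
  proof (rule ex1I[of _ y])
    fix z assume z: "z \<in> R \<and> x - z \<in> val_ideal v b"
    have "(x - y) - (x - z) \<in> val_ideal v b"
      using y z ideal_diff by blast
    then have "z - y \<in> val_ideal v b"
      by simp
    then show "z = y"
      using assms(4) y z by blast
  qed (use y in auto)
qed

lemma transversal_singleton: "transversal a a {0}"
  by (rule transversalI) auto

lemma sum_transversal_cong:
  fixes F :: "'f \<Rightarrow> 'm::comm_monoid_add"
  assumes R: "transversal a b R" and T: "transversal a b T" and F: "periodic a b F"
  shows "sum F R = sum F T"
proof -
  define h where "h x = (THE y. y \<in> T \<and> x - y \<in> val_ideal v b)" for x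
  have h: "h x \<in> T \<and> x - h x \<in> val_ideal v b" if "x \<in> R" for x
  proof -
    have "x \<in> val_ideal v a"
      using that transversal_subset[OF R] by blast
    from theI'[OF transversal_ex1[OF T this]] show ?thesis
      unfolding h_def .
  qed
  have "bij_betw h R T"
    unfolding bij_betw_def
  proof
    show "inj_on h R"
    proof (rule inj_onI)
      fix x y assume xy: "x \<in> R" "y \<in> R" "h x = h y"
      have "(x - h x) - (y - h y) \<in> val_ideal v b"
        using h[OF xy(1)] h[OF xy(2)] by (blast intro: ideal_diff)
      with xy show "x = y"
        using transversal_eqI[OF R, of x y] by simp
    qed
    show "h ` R = T"
    proof
      show "T \<subseteq> h ` R"
      proof
        fix y assume y: "y \<in> T"
        then have "y \<in> val_ideal v a"
          using transversal_subset[OF T] by blast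
        then obtain x where x: "x \<in> R" "y - x \<in> val_ideal v b"
          using transversal_ex[OF R] by blast
        have "(y - x) + (x - h x) \<in> val_ideal v b"
          using h[OF x(1)] x(2) by (blast intro: ideal_add)
        then have "y = h x"
          using transversal_eqI[OF T y, of "h x"] h[OF x(1)] by simp
        then show "y \<in> h ` R"
          using x(1) by blast
      qed
    qed (use h in auto)
  qed
  then have "sum F T = sum (F \<circ> h) R"
    by (simp add: sum.reindex_bij_betw comp_def)
  also have "\<dots> = sum F R"
  proof (rule sum.cong[OF refl])
    fix x assume x: "x \<in> R"
    have "x \<in> val_ideal v a" "h x \<in> val_ideal v a" "h x - x \<in> val_ideal v b"
      using h[OF x] x transversal_subset[OF R] transversal_subset[OF T]
        ideal_diff_commute[of "h x" x b]
      by blast+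
    then show "(F \<circ> h) x = F x"
      using periodicD[OF F, of "h x" x] by simp
  qed
  finally show ?thesis ..
qed

lemma card_transversal_eq:
  "transversal a b R \<Longrightarrow> transversal a b T \<Longrightarrow> card R = card T"
  using sum_transversal_cong[of a b R T "\<lambda>_. 1::nat"] by (simp add: periodic_def)

text \<open>Translations, dilations and the fractional linear maps by which the pro-\<open>p\<close> Iwahori subgroup
  moves cosets carry representatives to representatives for one common reason: they are onto, and
  isometric up to a shift.\<close>

lemma transversal_image:
  assumes R: "transversal a b R"
    and onto: "\<phi> ` val_ideal v a = val_ideal v a'"
    and iso: "\<And>x y. x \<in> val_ideal v a \<Longrightarrow> y \<in> val_ideal v a \<Longrightarrow>
      \<phi> x - \<phi> y \<in> val_ideal v b' \<longleftrightarrow> x - y \<in> val_ideal v b"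
  shows "transversal a' b' (\<phi> ` R)" "inj_on \<phi> R"
proof -
  have sub: "R \<subseteq> val_ideal v a"
    using R by (rule transversal_subset)
  show "transversal a' b' (\<phi> ` R)"
  proof (rule transversalI)
    fix x assume "x \<in> val_ideal v a'"
    then obtain z where z: "z \<in> val_ideal v a" "x = \<phi> z"
      using onto by blast
    obtain y where "y \<in> R" "z - y \<in> val_ideal v b"
      using transversal_ex[OF R z(1)] by blast
    then show "\<exists>y\<in>\<phi> ` R. x - y \<in> val_ideal v b'"
      using iso z sub by blast
  next
    fix x y assume "x \<in> \<phi> ` R" "y \<in> \<phi> ` R" "x - y \<in> val_ideal v b'"
    then obtain x' y' where "x = \<phi> x'" "y = \<phi> y'" "x' \<in> R" "y' \<in> R" "x' - y' \<in> val_ideal v b"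
      using iso sub by blast
    then show "x = y"
      using transversal_eqI[OF R] by blast
  qed (use transversal_finite[OF R] sub onto in auto)
  show "inj_on \<phi> R"
  proof (rule inj_onI)
    fix x y assume xy: "x \<in> R" "y \<in> R" "\<phi> x = \<phi> y"
    have "\<phi> x - \<phi> y \<in> val_ideal v b'"
      using xy by simp
    then have "x - y \<in> val_ideal v b"
      using iso[of x y] sub xy by blast
    then show "x = y"
      using transversal_eqI[OF R] xy by blast
  qed
qed

lemma sum_transversal_image:
  fixes F :: "'f \<Rightarrow> 'm::comm_monoid_add"
  assumes R: "transversal a b R" and T: "transversal a' b' T" and F: "periodic a' b' F"
    and onto: "\<phi> ` val_ideal v a = val_ideal v a'"
    and iso: "\<And>x y. x \<in> val_ideal v a \<Longrightarrow> y \<in> val_ideal v a \<Longrightarrow>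
      \<phi> x - \<phi> y \<in> val_ideal v b' \<longleftrightarrow> x - y \<in> val_ideal v b"
  shows "(\<Sum>x\<in>R. F (\<phi> x)) = sum F T"
proof -
  note tr = transversal_image[OF R onto iso]
  have "(\<Sum>x\<in>R. F (\<phi> x)) = sum F (\<phi> ` R)"
    using tr(2) by (simp add: sum.reindex)
  also have "\<dots> = sum F T"
    using sum_transversal_cong[OF tr(1) T F] .
  finally show ?thesis .
qed

lemma image_ideal_translate: "t \<in> val_ideal v a \<Longrightarrow> (\<lambda>x. x + t) ` val_ideal v a = val_ideal v a"
proof (intro equalityI subsetI)
  fix x assume "t \<in> val_ideal v a" "x \<in> val_ideal v a"
  then show "x \<in> (\<lambda>x. x + t) ` val_ideal v a"
    using ideal_diff[of x a t] by (intro image_eqI[of _ _ "x - t"]) auto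
qed (auto intro: ideal_add)

lemma sum_transversal_translate:
  fixes F :: "'f \<Rightarrow> 'm::comm_monoid_add"
  assumes "transversal a b R" "periodic a b F" "t \<in> val_ideal v a"
  shows "(\<Sum>x\<in>R. F (x + t)) = sum F R"
  by (rule sum_transversal_image[OF assms(1,1,2) image_ideal_translate[OF assms(3)]]) simp

lemma transversal_scale:
  assumes "transversal a b R" "s \<noteq> 0"
  shows "transversal (a + v s) (b + v s) ((*) s ` R)"
proof (rule transversal_image(1)[OF assms(1)])
  show "(*) s ` val_ideal v a = val_ideal v (a + v s)"
  proof (intro equalityI subsetI)
    fix x assume "x \<in> val_ideal v (a + v s)"
    then have "x / s \<in> val_ideal v a"
      using ideal_scale_iff[OF assms(2), of "x / s" "a + v s"] assms(2) by simp
    then show "x \<in> (*) s ` val_ideal v a"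
      using assms(2) by (intro image_eqI[of _ _ "x / s"]) auto
  qed (use assms(2) in \<open>auto simp: ideal_scale_iff\<close>)
next
  fix x y
  show "s * x - s * y \<in> val_ideal v (b + v s) \<longleftrightarrow> x - y \<in> val_ideal v b"
    using ideal_scale_iff[OF assms(2), of "x - y" "b + v s"] by (simp add: algebra_simps)
qed

text \<open>Refining a coset: representatives for the coarse quotient plus representatives for the
  subquotient.\<close>

lemma transversal_add:
  assumes R: "transversal a b R" and S: "transversal b c S" and "a \<le> b" "b \<le> c"
  shows "transversal a c ((\<lambda>(x, y). x + y) ` (R \<times> S))"
    and "inj_on (\<lambda>(x, y). x + y) (R \<times> S)"
proof -
  have uniq: "x = x' \<and> y = y'"
    if "x \<in> R" "x' \<in> R" "y \<in> S" "y' \<in> S" "(x + y) - (x' + y') \<in> val_ideal v c" for x x' y y'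
  proof -
    have "y - y' \<in> val_ideal v b"
      using that transversal_subset[OF S] by (blast intro: ideal_diff)
    then have "((x + y) - (x' + y')) - (y - y') \<in> val_ideal v b"
      using ideal_mono[OF that(5) \<open>b \<le> c\<close>] by (rule ideal_diff[rotated])
    then have "x - x' \<in> val_ideal v b"
      by (simp add: algebra_simps)
    then have "x = x'"
      using transversal_eqI[OF R] that by blast
    then have "y - y' \<in> val_ideal v c"
      using that by simp
    then show ?thesis
      using transversal_eqI[OF S] that \<open>x = x'\<close> by blast
  qed
  show "inj_on (\<lambda>(x, y). x + y) (R \<times> S)"
  proof (rule inj_onI, clarify)
    fix x y x' y' assume "x \<in> R" "y \<in> S" "x' \<in> R" "y' \<in> S" "x + y = x' + y'"
    then show "x = x' \<and> y = y'"
      using uniq[of x x' y y'] by simp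
  qed
  show "transversal a c ((\<lambda>(x, y). x + y) ` (R \<times> S))"
  proof (rule transversalI)
    fix x assume "x \<in> val_ideal v a"
    then obtain y where y: "y \<in> R" "x - y \<in> val_ideal v b"
      using transversal_ex[OF R] by blast
    then obtain z where "z \<in> S" "x - y - z \<in> val_ideal v c"
      using transversal_ex[OF S] by blast
    then show "\<exists>y\<in>(\<lambda>(x, y). x + y) ` (R \<times> S). x - y \<in> val_ideal v c"
      using y by (intro bexI[of _ "y + z"]) (auto simp: algebra_simps)
  next
    fix x y
    assume "x \<in> (\<lambda>(x, y). x + y) ` (R \<times> S)" "y \<in> (\<lambda>(x, y). x + y) ` (R \<times> S)"
      "x - y \<in> val_ideal v c"
    then obtain a b a' b' where "x = a + b" "y = a' + b'" "a \<in> R" "a' \<in> R" "b \<in> S" "b' \<in> S"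
      "(a + b) - (a' + b') \<in> val_ideal v c"
      by auto
    then show "x = y"
      using uniq[of a a' b b'] by simp
  next
    show "(\<lambda>(x, y). x + y) ` (R \<times> S) \<subseteq> val_ideal v a"
    proof clarify
      fix x y assume "x \<in> R" "y \<in> S"
      then have "x \<in> val_ideal v a" "y \<in> val_ideal v a"
        using transversal_subset[OF R] transversal_subset[OF S] ideal_mono[of y b a] \<open>a \<le> b\<close>
        by auto
      then show "x + y \<in> val_ideal v a"
        by (rule ideal_add)
    qed
  next
    show "finite ((\<lambda>(x, y). x + y) ` (R \<times> S))"
      by (intro finite_imageI finite_cartesian_product transversal_finite[OF R]
          transversal_finite[OF S])
  qed
qed

lemma sum_transversal_add:
  fixes F :: "'f \<Rightarrow> 'm::comm_monoid_add"
  assumes R: "transversal a b R" and S: "transversal b c S" and T: "transversal a c T"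
    and "a \<le> b" "b \<le> c" and F: "periodic a c F"
  shows "(\<Sum>x\<in>R. \<Sum>y\<in>S. F (x + y)) = sum F T"
proof -
  note tr = transversal_add[OF R S assms(4,5)]
  have "(\<Sum>x\<in>R. \<Sum>y\<in>S. F (x + y)) = sum F ((\<lambda>(x, y). x + y) ` (R \<times> S))"
    by (subst sum.reindex[OF tr(2)], subst sum.cartesian_product)
      (rule sum.cong, auto)
  also have "\<dots> = sum F T"
    using sum_transversal_cong[OF tr(1) T F] .
  finally show ?thesis .
qed

lemma periodic_mono: "periodic a b F \<Longrightarrow> b \<le> c \<Longrightarrow> periodic a c F"
  unfolding periodic_def using ideal_mono by blast

lemma transversal_restrict:
  assumes R: "transversal a b R" and "a \<le> c" "c \<le> b"
  shows "transversal c b (R \<inter> val_ideal v c)"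
proof (rule transversalI)
  fix x assume x: "x \<in> val_ideal v c"
  obtain y where y: "y \<in> R" "x - y \<in> val_ideal v b"
    using transversal_ex[OF R ideal_mono[OF x \<open>a \<le> c\<close>]] .
  have "y \<in> val_ideal v c"
    using ideal_diff[OF x ideal_mono[OF y(2) \<open>c \<le> b\<close>]] by simp
  with y show "\<exists>y\<in>R \<inter> val_ideal v c. x - y \<in> val_ideal v b"
    by blast
qed (use transversal_finite[OF R] transversal_eqI[OF R] in auto)

lemma sum_transversal_at_zero:
  fixes x :: "'m::comm_monoid_add"
  assumes R: "transversal a b R"
  shows "(\<Sum>y\<in>R. if y \<in> val_ideal v b then x else 0) = x"
proof -
  obtain z where z: "z \<in> R" "0 - z \<in> val_ideal v b"
    using transversal_ex[OF R, of 0] by auto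
  have "y \<in> val_ideal v b \<longleftrightarrow> y = z" if "y \<in> R" for y
  proof
    assume "y \<in> val_ideal v b"
    then have "y - z \<in> val_ideal v b"
      using z(2) ideal_diff[of y b z] by simp
    then show "y = z"
      using transversal_eqI[OF R that z(1)] by blast
  qed (use z in simp)
  then have "(\<Sum>y\<in>R. if y \<in> val_ideal v b then x else 0) = (\<Sum>y\<in>R. if y = z then x else 0)"
    by (intro sum.cong) auto
  also have "\<dots> = x"
    using z(1) transversal_finite[OF R] by simp
  finally show ?thesis .
qed

end


section \<open>The residue field and Teichmueller representatives\<close>

context discretely_valued
begin

lemma valuation_ring_simps [simp]:
  "carrier (valuation_ring v) = val_ideal v 0"
  "x \<oplus>\<^bsub>valuation_ring v\<^esub> y = x + y" "x \<otimes>\<^bsub>valuation_ring v\<^esub> y = x * y"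
  "\<zero>\<^bsub>valuation_ring v\<^esub> = 0" "\<one>\<^bsub>valuation_ring v\<^esub> = 1"
  by (simp_all add: valuation_ring_def ring_of_type_algebra_def)

lemma valuation_ring_cring: "cring (valuation_ring v)"
proof (rule cringI)
  show "abelian_group (valuation_ring v)"
  proof (rule abelian_groupI)
    fix x assume "x \<in> carrier (valuation_ring v)"
    then show "\<exists>y\<in>carrier (valuation_ring v). y \<oplus>\<^bsub>valuation_ring v\<^esub> x = \<zero>\<^bsub>valuation_ring v\<^esub>"
      by (intro bexI[of _ "- x"]) simp_all
  qed (simp_all add: ideal_add algebra_simps)
  show "comm_monoid (valuation_ring v)"
    by (rule comm_monoidI) (simp_all add: ideal_mult_0 algebra_simps)
qed (simp add: algebra_simps)

lemma maximal_ideal_ideal: "ideal (val_ideal v 1) (valuation_ring v)"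
proof (rule idealI)
  show "ring (valuation_ring v)"
    using valuation_ring_cring by (rule cring.axioms)
  then interpret ring "valuation_ring v" .
  show "subgroup (val_ideal v 1) (add_monoid (valuation_ring v))"
  proof (rule add.subgroupI)
    fix x assume x: "x \<in> val_ideal v 1"
    then have "x \<in> val_ideal v 0"
      by (rule ideal_mono) simp
    then have "\<ominus>\<^bsub>valuation_ring v\<^esub> x = - x"
      by (intro minus_equality) simp_all
    then show "\<ominus>\<^bsub>valuation_ring v\<^esub> x \<in> val_ideal v 1"
      using x by simp
  next
    show "val_ideal v 1 \<noteq> {}"
      using zero_in_ideal by blast
  next
    fix x y assume "x \<in> val_ideal v 1" "y \<in> val_ideal v 1"
    then show "x \<oplus>\<^bsub>valuation_ring v\<^esub> y \<in> val_ideal v 1"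
      by (simp add: ideal_add)
  next
    show "val_ideal v 1 \<subseteq> carrier (valuation_ring v)"
      using ideal_mono[of _ 1 0] by auto
  qed
qed (simp_all add: ideal_mult_0 ideal_mult_0')

lemma mem_residue_class: "y \<in> residue_class v x \<longleftrightarrow> y - x \<in> val_ideal v 1"
proof -
  have "y \<in> residue_class v x \<longleftrightarrow> (\<exists>h\<in>val_ideal v 1. y = h + x)"
    by (simp add: residue_class_def a_r_coset_def' valuation_ring_def ring_of_type_algebra_def
        set_eq_iff)
  also have "\<dots> \<longleftrightarrow> y - x \<in> val_ideal v 1"
    by (auto intro!: bexI[of _ "y - x"])
  finally show ?thesis .
qed

lemma carrier_residue_field: "carrier (residue_field v) = residue_class v ` val_ideal v 0"
  by (auto simp: residue_field_def FactRing_def A_RCOSETS_def' residue_class_def)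

lemma residue_class_eq_iff: "residue_class v x = residue_class v y \<longleftrightarrow> x - y \<in> val_ideal v 1"
proof
  assume "residue_class v x = residue_class v y"
  moreover have "x \<in> residue_class v x"
    by (simp add: mem_residue_class)
  ultimately show "x - y \<in> val_ideal v 1"
    by (simp add: mem_residue_class)
next
  assume xy: "x - y \<in> val_ideal v 1"
  have "z - x \<in> val_ideal v 1 \<longleftrightarrow> z - y \<in> val_ideal v 1" for z
    using ideal_add[OF _ xy, of "z - x"] ideal_diff[OF _ xy, of "z - y"] by auto
  then show "residue_class v x = residue_class v y"
    by (simp add: set_eq_iff mem_residue_class)
qed

lemma residue_class_of_mem: "c \<in> carrier (residue_field v) \<Longrightarrow> x \<in> c \<Longrightarrow> residue_class v x = c"
  unfolding carrier_residue_field using mem_residue_class residue_class_eq_iff by blast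

lemma residue_class_add:
  assumes "x \<in> val_ideal v 0" "y \<in> val_ideal v 0"
  shows "residue_class v x \<oplus>\<^bsub>residue_field v\<^esub> residue_class v y = residue_class v (x + y)"
  using assms abelian_subgroup.a_rcos_sum[OF abelian_subgroupI3
      [OF ideal.axioms(1)[OF maximal_ideal_ideal] ring.is_abelian_group]]
    ideal.axioms(2)[OF maximal_ideal_ideal]
  by (simp add: residue_field_def FactRing_def residue_class_def)

lemma residue_class_mult:
  assumes "x \<in> val_ideal v 0" "y \<in> val_ideal v 0"
  shows "residue_class v x \<otimes>\<^bsub>residue_field v\<^esub> residue_class v y = residue_class v (x * y)"
  using assms ideal.rcoset_mult_add[OF maximal_ideal_ideal, of x y]
  by (simp add: residue_field_def FactRing_def residue_class_def)

lemma one_residue_field: "\<one>\<^bsub>residue_field v\<^esub> = residue_class v 1"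
  by (simp add: residue_field_def FactRing_def residue_class_def)

end

locale residue_setting = discretely_valued v for v :: "'f::field \<Rightarrow> int" +
  fixes \<pi> :: 'f and \<iota> :: "'f set \<Rightarrow> 'k::field" and p e :: nat
  assumes complete: "valuation_complete v"
    and finite_residue: "finite (carrier (residue_field v))"
    and prime: "Factorial_Ring.prime p"
    and card_residue: "card (carrier (residue_field v)) = p ^ e"
    and uniformizer: "uniformizer v \<pi>"
    and char: "CHAR('k) = p"
    and embedding: "\<iota> \<in> ring_hom (residue_field v) (ring_of_type_algebra :: 'k ring)"
begin

lemma uniformizer_nonzero [simp]: "\<pi> \<noteq> 0" and val_uniformizer [simp]: "v \<pi> = 1"
  using uniformizer by (auto simp: uniformizer_def)

text \<open>Residues are read off in the coefficient field, where the arithmetic of a type is available.\<close>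

definition red :: "'f \<Rightarrow> 'k" where
  "red x = \<iota> (residue_class v x)"

lemma red_add: "x \<in> val_ideal v 0 \<Longrightarrow> y \<in> val_ideal v 0 \<Longrightarrow> red (x + y) = red x + red y"
  using ring_hom_add[OF embedding, of "residue_class v x" "residue_class v y"]
  by (simp add: red_def residue_class_add carrier_residue_field ring_of_type_algebra_def)

lemma red_mult: "x \<in> val_ideal v 0 \<Longrightarrow> y \<in> val_ideal v 0 \<Longrightarrow> red (x * y) = red x * red y"
  using ring_hom_mult[OF embedding, of "residue_class v x" "residue_class v y"]
  by (simp add: red_def residue_class_mult carrier_residue_field ring_of_type_algebra_def)

lemma red_1 [simp]: "red 1 = 1"
  using ring_hom_one[OF embedding]
  by (simp add: red_def one_residue_field ring_of_type_algebra_def)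

lemma red_0 [simp]: "red 0 = 0"
  using red_add[of 0 0] add_left_cancel[of "red 0" "red 0" 0] by simp

lemma red_minus: "x \<in> val_ideal v 0 \<Longrightarrow> red (- x) = - red x"
  using red_add[of x "- x"] by (simp add: eq_neg_iff_add_eq_0 add.commute)

lemma red_diff: "x \<in> val_ideal v 0 \<Longrightarrow> y \<in> val_ideal v 0 \<Longrightarrow> red (x - y) = red x - red y"
  using red_add[of x "- y"] by (simp add: red_minus)

lemma red_power: "x \<in> val_ideal v 0 \<Longrightarrow> red (x ^ n) = red x ^ n"
  by (induction n) (auto simp: red_mult ideal_power_0)

lemma red_of_nat: "red (of_nat n) = of_nat n"
proof (induction n)
  case (Suc n)
  have "of_nat n \<in> val_ideal v 0"
    by (induction n) (auto intro: ideal_add)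
  then show ?case
    using Suc by (simp add: red_add)
qed simp

lemma red_eq_0_iff: "x \<in> val_ideal v 0 \<Longrightarrow> red x = 0 \<longleftrightarrow> x \<in> val_ideal v 1"
proof
  assume x: "x \<in> val_ideal v 0" "red x = 0"
  show "x \<in> val_ideal v 1"
  proof (rule ccontr)
    assume "x \<notin> val_ideal v 1"
    then have "x \<noteq> 0" "v x = 0"
      using unit_val x by auto
    then have "red x * red (inverse x) = 1"
      using red_mult[of x "inverse x"] x by (simp add: in_ideal_iff val_inverse)
    with x show False
      by simp
  qed
next
  assume "x \<in> val_ideal v 1"
  then have "residue_class v x = residue_class v 0"
    by (simp add: residue_class_eq_iff)
  then show "red x = 0"
    using red_0 by (simp add: red_def)
qed

lemma red_eq_iff:
  "x \<in> val_ideal v 0 \<Longrightarrow> y \<in> val_ideal v 0 \<Longrightarrow> red x = red y \<longleftrightarrow> x - y \<in> val_ideal v 1"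
  using red_eq_0_iff[of "x - y"] ideal_diff[of x 0 y] by (simp add: red_diff)

definition q :: nat where
  "q = card (carrier (residue_field v))"

lemma q_gt_1: "q > 1"
proof -
  have "residue_class v 0 \<noteq> residue_class v 1"
    using one_notin_ideal_1 ideal_minus_iff[of 1 1] by (simp add: residue_class_eq_iff)
  moreover have "{residue_class v 0, residue_class v 1} \<subseteq> carrier (residue_field v)"
    by (auto simp: carrier_residue_field)
  ultimately have "2 \<le> q"
    using card_mono[OF finite_residue, of "{residue_class v 0, residue_class v 1}"]
    by (simp add: q_def)
  then show ?thesis
    by linarith
qed

lemma of_nat_q [simp]: "(of_nat q :: 'k) = 0"
proof -
  have "e \<noteq> 0"
    using q_gt_1 card_residue by (cases e) (auto simp: q_def)
  then have "p dvd q"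
    by (simp add: q_def card_residue)
  then show ?thesis
    by (simp add: of_nat_eq_0_iff_char_dvd char)
qed

text \<open>The nonzero residues are permuted by multiplication with a unit, so comparing the products of
  all of them gives the fixed points of the \<open>q\<close>-th power map.\<close>

lemma red_power_q:
  assumes x: "x \<in> val_ideal v 0"
  shows "red x ^ q = red x"
proof (cases "red x = 0")
  case True
  then show ?thesis
    using q_gt_1 by simp
next
  case False
  let ?K = "red ` val_ideal v 0"
  have K: "?K = \<iota> ` carrier (residue_field v)"
    by (auto simp: red_def carrier_residue_field)
  have fin: "finite ?K"
    using finite_residue by (simp add: K)
  have "inj_on \<iota> (carrier (residue_field v))"
    unfolding inj_on_def carrier_residue_field
    by (simp add: residue_class_eq_iff red_eq_iff flip: red_def)
  then have "card ?K = q"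
    by (simp add: K card_image q_def)
  moreover have "0 \<in> ?K"
    by (auto intro!: image_eqI[of _ _ 0])
  ultimately have card: "card (?K - {0}) = q - 1"
    using fin by simp
  have inj: "inj_on ((*) (red x)) (?K - {0})"
    using False by (auto intro: inj_onI)
  have "(*) (red x) ` (?K - {0}) \<subseteq> ?K - {0}"
    using False x by (auto simp: ideal_mult_0 intro!: image_eqI[where x="x * _"] red_mult[symmetric])
  then have "(*) (red x) ` (?K - {0}) = ?K - {0}"
    using endo_inj_surj[of "?K - {0}"] fin inj by blast
  then have "prod (\<lambda>a. a) (?K - {0}) = (\<Prod>a\<in>?K - {0}. red x * a)"
    using inj prod.reindex[OF inj, of "\<lambda>a. a"] by simp
  also have "\<dots> = red x ^ (q - 1) * prod (\<lambda>a. a) (?K - {0})"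
    by (simp add: prod.distrib card)
  finally have "red x ^ (q - 1) = 1"
    using fin by (simp add: prod_zero_iff)
  then show ?thesis
    using q_gt_1 power_Suc[of "red x" "q - 1"] by simp
qed

text \<open>Modulo \<open>\<p>\<close> this is \<open>q\<close> copies of \<open>x ^ (q - 1)\<close>, hence \<open>0\<close>. As the cofactor of \<open>x - y\<close> in
  \<open>x ^ q - y ^ q\<close>, it makes the \<open>q\<close>-th power map a contraction on each residue class, which gives both
  the existence and the uniqueness of Teichmueller lifts.\<close>

lemma geometric_sum_in_ideal:
  assumes x: "x \<in> val_ideal v 0" and y: "y \<in> val_ideal v 0" and xy: "x - y \<in> val_ideal v 1"
  shows "(\<Sum>i<q. y ^ (q - Suc i) * x ^ i) \<in> val_ideal v 1"
proof -
  have mem: "(\<Sum>i\<in>A. y ^ f i * x ^ g i) \<in> val_ideal v 0" for A :: "nat set" and f g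
    using x y by (induction A rule: infinite_finite_induct)
      (auto intro!: ideal_add ideal_mult_0 ideal_power_0)
  have "red (\<Sum>i\<in>A. y ^ f i * x ^ g i) = (\<Sum>i\<in>A. red y ^ f i * red x ^ g i)" for A :: "nat set" and f g
    using x y mem by (induction A rule: infinite_finite_induct)
      (simp_all add: red_add red_mult red_power ideal_mult_0 ideal_power_0)
  then have "red (\<Sum>i<q. y ^ (q - Suc i) * x ^ i) = (\<Sum>i<q. red x ^ (q - Suc i) * red x ^ i)"
    using xy red_eq_iff[OF x y] by simp
  also have "\<dots> = (\<Sum>i<q. red x ^ (q - 1))"
    by (intro sum.cong) (auto simp flip: power_add)
  also have "\<dots> = 0"
    by (simp only: sum_constant card_lessThan of_nat_q mult_zero_left)
  finally show ?thesis
    using red_eq_0_iff[OF mem] by simp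
qed

lemma power_q_contracts:
  assumes "x \<in> val_ideal v 0" "y \<in> val_ideal v 0" "x - y \<in> val_ideal v n" "1 \<le> n"
  shows "x ^ q - y ^ q \<in> val_ideal v (n + 1)"
proof -
  have "x ^ q - y ^ q = (x - y) * (\<Sum>i<q. y ^ (q - Suc i) * x ^ i)"
    by (rule power_diff_sumr2)
  then show ?thesis
    using ideal_mult[OF assms(3) geometric_sum_in_ideal] assms ideal_mono by simp
qed

text \<open>By the contraction property the iterates of the \<open>q\<close>-th power map converge, and the limit is a
  fixed point.\<close>

lemma teichmueller_exists:
  assumes x: "x \<in> val_ideal v 0"
  shows "\<exists>y. y - x \<in> val_ideal v 1 \<and> y ^ q = y"
proof -
  define s where "s n = x ^ (q ^ n)" for n
  have s_in: "s n \<in> val_ideal v 0" for n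
    using x by (simp add: s_def ideal_power_0)
  have s_Suc: "s (Suc n) = s n ^ q" for n
    by (simp add: s_def power_mult[symmetric] mult.commute)
  have step: "s (Suc n) - s n \<in> val_ideal v (int n + 1)" for n
  proof (induction n)
    case 0
    have "red (s (Suc 0) - s 0) = 0"
      using red_power_q[OF x] x by (simp add: s_def red_diff ideal_power_0 red_power)
    moreover have "s (Suc 0) - s 0 \<in> val_ideal v 0"
      using s_in ideal_diff by blast
    ultimately show ?case
      using red_eq_0_iff by simp
  next
    case (Suc n)
    then show ?case
      using power_q_contracts[OF s_in s_in Suc] by (simp add: s_Suc add.commute)
  qed
  have near: "s (m + k) - s m \<in> val_ideal v (int m + 1)" for m k
  proof (induction k)
    case (Suc k)
    have "s (Suc (m + k)) - s (m + k) \<in> val_ideal v (int m + 1)"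
      using step[of "m + k"] by (rule ideal_mono) simp
    from ideal_add[OF this Suc] show ?case
      by simp
  qed simp
  have "\<exists>M. \<forall>i\<ge>M. \<forall>j\<ge>M. s i - s j \<in> val_ideal v n" for n
  proof (intro exI[of _ "nat n"] allI impI)
    fix i j assume "nat n \<le> i" "nat n \<le> j"
    then have "s i - s (nat n) \<in> val_ideal v (int (nat n) + 1)"
      "s j - s (nat n) \<in> val_ideal v (int (nat n) + 1)"
      using near[of "nat n" "i - nat n"] near[of "nat n" "j - nat n"] by simp_all
    from ideal_diff[OF this] have "s i - s j \<in> val_ideal v (int (nat n) + 1)"
      by simp
    then show "s i - s j \<in> val_ideal v n"
      by (rule ideal_mono) simp
  qed
  then obtain y where y: "\<And>n. \<exists>M. \<forall>i\<ge>M. s i - y \<in> val_ideal v n"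
    using complete[unfolded valuation_complete_def, rule_format, of s] by blast
  have close: "s m - y \<in> val_ideal v (int m + 1)" for m
  proof -
    obtain M where "\<forall>i\<ge>M. s i - y \<in> val_ideal v (int m + 1)"
      using y by blast
    then have "s (m + M) - y \<in> val_ideal v (int m + 1)"
      by simp
    from ideal_diff[OF this near[of m M]] show ?thesis
      by simp
  qed
  have yx: "y - x \<in> val_ideal v 1"
    using close[of 0] ideal_diff_commute[of y x 1] by (simp add: s_def)
  have y_in: "y \<in> val_ideal v 0"
    using ideal_add[OF ideal_mono[OF yx] x] by simp
  have "y ^ q - y \<in> val_ideal v (int m)" for m
  proof -
    have "s (Suc m) - y ^ q \<in> val_ideal v (int m + 1 + 1)"
      unfolding s_Suc by (rule power_q_contracts[OF s_in y_in close]) simp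
    then have "s (Suc m) - y ^ q \<in> val_ideal v (int m)"
      by (rule ideal_mono) simp
    moreover have "s (Suc m) - y \<in> val_ideal v (int m)"
      using close[of "Suc m"] by (rule ideal_mono) simp
    ultimately have "(s (Suc m) - y) - (s (Suc m) - y ^ q) \<in> val_ideal v (int m)"
      by (rule ideal_diff[rotated])
    then show ?thesis
      by simp
  qed
  then have "y ^ q = y"
    using in_all_ideals_imp_zero[of "y ^ q - y"] by simp
  with yx show ?thesis
    by blast
qed

lemma teichmueller_unique:
  assumes x: "x \<in> val_ideal v 0" and y: "y \<in> val_ideal v 0" and xy: "x - y \<in> val_ideal v 1"
    and "x ^ q = x" "y ^ q = y"
  shows "x = y"
proof (rule ccontr)
  assume "x \<noteq> y"
  let ?S = "\<Sum>i<q. y ^ (q - Suc i) * x ^ i"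
  have "(x - y) * ?S = x ^ q - y ^ q"
    by (rule power_diff_sumr2[symmetric])
  also have "\<dots> = (x - y) * 1"
    using assms by simp
  finally have "?S = 1"
    using \<open>x \<noteq> y\<close> mult_left_cancel[of "x - y" ?S 1] by simp
  then show False
    using geometric_sum_in_ideal[OF x y xy] by simp
qed

lemma teichmueller_mem:
  assumes "c \<in> carrier (residue_field v)"
  shows "teichmueller v c \<in> c"
proof -
  obtain x where x: "x \<in> val_ideal v 0" "c = residue_class v x"
    using assms by (auto simp: carrier_residue_field)
  have sub: "y \<in> val_ideal v 0" if "y \<in> c" for y
  proof -
    have "y - x \<in> val_ideal v 0"
      using that x ideal_mono[of _ 1 0] by (simp add: mem_residue_class)
    from ideal_add[OF this x(1)] show ?thesis
      by simp
  qed
  have "\<exists>!y. y \<in> c \<and> y ^ q = y"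
  proof (rule ex_ex1I)
    show "\<exists>y. y \<in> c \<and> y ^ q = y"
      using teichmueller_exists[OF x(1)] by (simp add: x mem_residue_class)
    fix y z assume yz: "y \<in> c \<and> y ^ q = y" "z \<in> c \<and> z ^ q = z"
    then have "y - x \<in> val_ideal v 1" "z - x \<in> val_ideal v 1"
      by (simp_all add: x mem_residue_class)
    from ideal_diff[OF this] yz show "y = z"
      using teichmueller_unique[of y z] sub by simp
  qed
  from theI'[OF this] show ?thesis
    by (simp add: teichmueller_def q_def)
qed

text \<open>The expansions with \<open>m\<close> digits represent \<open>\<o> / \<p>\<^sup>m\<close> because each Teichmueller lift lies in its
  residue class.\<close>

definition digit_lists :: "nat \<Rightarrow> 'f set list set" where
  "digit_lists m = {ls. set ls \<subseteq> carrier (residue_field v) \<and> length ls = m}"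

lemma digit_lists_Suc:
  "ls \<in> digit_lists (Suc m) \<longleftrightarrow>
    (\<exists>c ls'. ls = c # ls' \<and> c \<in> carrier (residue_field v) \<and> ls' \<in> digit_lists m)"
  by (cases ls) (auto simp: digit_lists_def)

lemma finite_digit_lists: "finite (digit_lists m)"
  unfolding digit_lists_def by (rule finite_lists_length_eq[OF finite_residue])

lemma teich_sum_Cons: "teich_sum v \<pi> (c # ls) = teichmueller v c + \<pi> * teich_sum v \<pi> ls"
  unfolding teich_sum_def length_Cons sum.lessThan_Suc_shift
  by (simp add: sum_distrib_left mult_ac)

lemma residue_class_teichmueller:
  "c \<in> carrier (residue_field v) \<Longrightarrow> residue_class v (teichmueller v c) = c"
  using residue_class_of_mem teichmueller_mem by blast

lemma teichmueller_in_ring: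
  assumes "c \<in> carrier (residue_field v)"
  shows "teichmueller v c \<in> val_ideal v 0"
proof -
  obtain x where x: "x \<in> val_ideal v 0" "c = residue_class v x"
    using assms by (auto simp: carrier_residue_field)
  then have "teichmueller v c - x \<in> val_ideal v 1"
    using teichmueller_mem[OF assms] by (simp add: mem_residue_class)
  then have "teichmueller v c - x \<in> val_ideal v 0"
    by (rule ideal_mono) simp
  from ideal_add[OF this x(1)] show ?thesis
    by simp
qed

lemma uniformizer_mult_in_ideal: "x \<in> val_ideal v n \<Longrightarrow> \<pi> * x \<in> val_ideal v (n + 1)"
  using ideal_scale_iff[of \<pi> x "n + 1"] by simp

lemma teich_sum_in_ring: "ls \<in> digit_lists m \<Longrightarrow> teich_sum v \<pi> ls \<in> val_ideal v 0"
proof (induction m arbitrary: ls)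
  case (Suc m)
  then obtain c ls' where ls: "ls = c # ls'" "c \<in> carrier (residue_field v)" "ls' \<in> digit_lists m"
    by (auto simp: digit_lists_Suc)
  have "\<pi> * teich_sum v \<pi> ls' \<in> val_ideal v 0"
    using uniformizer_mult_in_ideal[OF Suc.IH[OF ls(3)]] by (rule ideal_mono) simp
  from ideal_add[OF teichmueller_in_ring[OF ls(2)] this] show ?case
    by (simp add: ls(1) teich_sum_Cons)
qed (simp add: digit_lists_def teich_sum_def)

lemma teich_sum_eqI:
  "ls \<in> digit_lists m \<Longrightarrow> ls' \<in> digit_lists m \<Longrightarrow>
    teich_sum v \<pi> ls - teich_sum v \<pi> ls' \<in> val_ideal v (int m) \<Longrightarrow> ls = ls'"
proof (induction m arbitrary: ls ls')
  case (Suc m)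
  from Suc.prems(1) obtain c l where ls: "ls = c # l" "c \<in> carrier (residue_field v)" "l \<in> digit_lists m"
    by (auto simp: digit_lists_Suc)
  from Suc.prems(2) obtain c' l' where ls': "ls' = c' # l'" "c' \<in> carrier (residue_field v)"
    "l' \<in> digit_lists m"
    by (auto simp: digit_lists_Suc)
  let ?d = "teich_sum v \<pi> l - teich_sum v \<pi> l'"
  have eq: "teich_sum v \<pi> ls - teich_sum v \<pi> ls' = teichmueller v c - teichmueller v c' + \<pi> * ?d"
    by (simp add: ls(1) ls'(1) teich_sum_Cons algebra_simps)
  have "?d \<in> val_ideal v 0"
    using teich_sum_in_ring[OF ls(3)] teich_sum_in_ring[OF ls'(3)] by (rule ideal_diff)
  then have "\<pi> * ?d \<in> val_ideal v 1"
    using uniformizer_mult_in_ideal[of ?d 0] by simp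
  moreover have "teich_sum v \<pi> ls - teich_sum v \<pi> ls' \<in> val_ideal v 1"
    using Suc.prems(3) by (rule ideal_mono) simp
  ultimately have "teichmueller v c - teichmueller v c' \<in> val_ideal v 1"
    using ideal_diff[of "teich_sum v \<pi> ls - teich_sum v \<pi> ls'" 1 "\<pi> * ?d"] eq by simp
  then have c: "c = c'"
    using residue_class_eq_iff residue_class_teichmueller ls(2) ls'(2) by metis
  then have "\<pi> * ?d \<in> val_ideal v (int (Suc m))"
    using Suc.prems(3) eq by simp
  then have "?d \<in> val_ideal v (int m)"
    using ideal_scale_iff[of \<pi> ?d "int (Suc m)"] by simp
  then have "l = l'"
    using Suc.IH ls ls' by blast
  with c show ?case
    by (simp add: ls ls')
qed (simp add: digit_lists_def)

lemma teich_sum_approximates: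
  "x \<in> val_ideal v 0 \<Longrightarrow> \<exists>ls\<in>digit_lists m. x - teich_sum v \<pi> ls \<in> val_ideal v (int m)"
proof (induction m arbitrary: x)
  case 0
  then show ?case
    by (intro bexI[of _ "[]"]) (simp_all add: teich_sum_def digit_lists_def)
next
  case (Suc m)
  define c where "c = residue_class v x"
  have c: "c \<in> carrier (residue_field v)"
    using Suc.prems by (simp add: c_def carrier_residue_field)
  have "teichmueller v c - x \<in> val_ideal v 1"
    using teichmueller_mem[OF c] by (simp add: c_def mem_residue_class)
  then have "x - teichmueller v c \<in> val_ideal v 1"
    using ideal_diff_commute by blast
  then have "(x - teichmueller v c) / \<pi> \<in> val_ideal v 0"
    using ideal_scale_iff[of \<pi> "(x - teichmueller v c) / \<pi>" 1] by simp
  then obtain ls where ls: "ls \<in> digit_lists m"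
    "(x - teichmueller v c) / \<pi> - teich_sum v \<pi> ls \<in> val_ideal v (int m)"
    using Suc.IH by blast
  have "\<pi> * ((x - teichmueller v c) / \<pi> - teich_sum v \<pi> ls) \<in> val_ideal v (int m + 1)"
    using uniformizer_mult_in_ideal[OF ls(2)] .
  also have "\<pi> * ((x - teichmueller v c) / \<pi> - teich_sum v \<pi> ls) = x - teich_sum v \<pi> (c # ls)"
    by (simp add: teich_sum_Cons field_simps)
  finally show ?case
    using c ls(1) by (intro bexI[of _ "c # ls"]) (auto simp: digit_lists_Suc add.commute)
qed

lemma inj_on_teich_sum: "inj_on (teich_sum v \<pi>) (digit_lists m)"
  by (rule inj_onI) (rule teich_sum_eqI, simp_all)

lemma transversal_teich_sum: "transversal 0 (int m) (teich_sum v \<pi> ` digit_lists m)"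
proof (rule transversalI)
  fix x y assume "x \<in> teich_sum v \<pi> ` digit_lists m" "y \<in> teich_sum v \<pi> ` digit_lists m"
    "x - y \<in> val_ideal v (int m)"
  then show "x = y"
    using teich_sum_eqI by blast
qed (use teich_sum_approximates teich_sum_in_ring finite_digit_lists in auto)

lemma transversal_exists:
  assumes "a \<le> b"
  obtains R where "transversal a b R"
proof -
  have "transversal (0 + v (\<pi> powi a)) (int (nat (b - a)) + v (\<pi> powi a))
      ((*) (\<pi> powi a) ` teich_sum v \<pi> ` digit_lists (nat (b - a)))"
    by (rule transversal_scale[OF transversal_teich_sum]) simp
  then show thesis
    using that assms by (simp add: val_power_int)
qed

lemma card_transversal_Suc:
  assumes "transversal a (a + 1) R"
  shows "card R = q"
proof -
  have "transversal (0 + v (\<pi> powi a)) (int 1 + v (\<pi> powi a))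
      ((*) (\<pi> powi a) ` teich_sum v \<pi> ` digit_lists 1)"
    by (rule transversal_scale[OF transversal_teich_sum]) simp
  then have "card R = card ((*) (\<pi> powi a) ` teich_sum v \<pi> ` digit_lists 1)"
    using assms by (intro card_transversal_eq) (simp_all add: val_power_int add.commute)
  also have "\<dots> = card (digit_lists 1)"
    by (subst card_image, simp add: inj_on_def, rule card_image[OF inj_on_teich_sum])
  also have "\<dots> = q"
    using card_lists_length_eq[OF finite_residue, of 1] by (simp add: digit_lists_def q_def)
  finally show ?thesis .
qed

lemma card_transversal_nonzero:
  assumes R: "transversal a (a + 1) R"
  shows "card {x \<in> R. x \<notin> val_ideal v (a + 1)} = q - 1"
proof -
  have "(\<Sum>y\<in>R. if y \<in> val_ideal v (a + 1) then 1 else 0) = (1::nat)"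
    by (rule sum_transversal_at_zero[OF R])
  then have "card {x \<in> R. x \<in> val_ideal v (a + 1)} = 1"
    using transversal_finite[OF R] by (simp add: sum.If_cases Int_def)
  moreover have "R = {x \<in> R. x \<in> val_ideal v (a + 1)} \<union> {x \<in> R. x \<notin> val_ideal v (a + 1)}"
    by blast
  then have "card R = card {x \<in> R. x \<in> val_ideal v (a + 1)} + card {x \<in> R. x \<notin> val_ideal v (a + 1)}"
    using transversal_finite[OF R] card_Un_disjoint[of "{x \<in> R. x \<in> val_ideal v (a + 1)}"
        "{x \<in> R. x \<notin> val_ideal v (a + 1)}"] by fastforce
  ultimately show ?thesis
    using card_transversal_Suc[OF R] by simp
qed

end


section \<open>Two by two matrices\<close>

text \<open>The symbol for coefficients of power series is the one for entries of matrices.\<close>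

no_notation fps_nth (infixl "$" 75)

lemma mat2_nth [simp]:
  "mat2 a b c d $ 1 $ 1 = a" "mat2 a b c d $ 1 $ 2 = b"
  "mat2 a b c d $ 2 $ 1 = c" "mat2 a b c d $ 2 $ 2 = d"
  by (simp_all add: mat2_def)

lemma mat2_eq_iff: "A = B \<longleftrightarrow>
    A $ 1 $ 1 = B $ 1 $ 1 \<and> A $ 1 $ 2 = B $ 1 $ 2 \<and> A $ 2 $ 1 = B $ 2 $ 1 \<and> A $ 2 $ 2 = B $ 2 $ 2"
  for A B :: "'a ^ 2 ^ 2"
  by (auto simp: vec_eq_iff forall_2)

lemma mat2_eta: "A = mat2 (A $ 1 $ 1) (A $ 1 $ 2) (A $ 2 $ 1) (A $ 2 $ 2)"
  by (simp add: mat2_eq_iff)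

lemma mat2_cases:
  obtains a b c d where "A = mat2 a b c d"
  using mat2_eta by blast

lemma mat2_inject [simp]: "mat2 a b c d = mat2 a' b' c' d' \<longleftrightarrow> a = a' \<and> b = b' \<and> c = c' \<and> d = d'"
  by (simp add: mat2_eq_iff)

lemma mat2_mult [simp]:
  "mat2 a b c d ** mat2 a' b' c' d' =
    mat2 (a * a' + b * c') (a * b' + b * d') (c * a' + d * c') (c * b' + d * d')"
  for a :: "'a::semiring_1"
  by (simp add: mat2_eq_iff matrix_matrix_mult_def sum_2)

lemma mat_1_mat2: "(mat 1 :: 'a::zero_neq_one ^ 2 ^ 2) = mat2 1 0 0 1"
  by (simp add: mat2_eq_iff mat_def)

lemma det_mat2 [simp]: "det (mat2 a b c d) = a * d - b * c"
  for a :: "'a::comm_ring_1"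
  by (simp add: det_2)

lemma carrier_SL2 [simp]: "g \<in> carrier SL2 \<longleftrightarrow> det g = 1"
  and mult_SL2 [simp]: "g \<otimes>\<^bsub>SL2\<^esub> h = g ** h"
  and one_SL2: "\<one>\<^bsub>SL2\<^esub> = mat 1"
  by (simp_all add: SL2_def)

lemma SL2_left_inverse:
  fixes a :: "'f::field"
  assumes "a * d - b * c = 1"
  shows "mat2 d (- b) (- c) a ** mat2 a b c d = mat 1"
  using assms by (simp add: mat_1_mat2 algebra_simps)

lemma SL2_group: "Group.group (SL2 :: ('f::field ^ 2 ^ 2) monoid)"
proof (rule groupI)
  fix g :: "'f ^ 2 ^ 2" assume g: "g \<in> carrier SL2"
  obtain a b c d where abcd: "g = mat2 a b c d"
    by (rule mat2_cases)
  show "\<exists>h\<in>carrier SL2. h \<otimes>\<^bsub>SL2\<^esub> g = \<one>\<^bsub>SL2\<^esub>"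
    using g SL2_left_inverse[of a d b c]
    by (intro bexI[of _ "mat2 d (- b) (- c) a"]) (simp_all add: abcd one_SL2 mult.commute)
qed (simp_all add: one_SL2 det_mul matrix_mul_assoc)

lemma inv_SL2:
  fixes a :: "'f::field"
  assumes "a * d - b * c = 1"
  shows "inv\<^bsub>SL2\<^esub> (mat2 a b c d) = mat2 d (- b) (- c) a"
  by (rule group.inv_equality[OF SL2_group])
    (use SL2_left_inverse[OF assms] assms in \<open>simp_all add: one_SL2 algebra_simps\<close>)

lemma SL2_inv_cancel:
  fixes g :: "'f::field ^ 2 ^ 2"
  assumes "det g = 1"
  shows "inv\<^bsub>SL2\<^esub> g ** g = mat 1" "g ** inv\<^bsub>SL2\<^esub> g = mat 1" "det (inv\<^bsub>SL2\<^esub> g) = 1"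
  using assms group.l_inv[OF SL2_group, of g] group.r_inv[OF SL2_group, of g]
    group.inv_closed[OF SL2_group, of g]
  by (simp_all add: one_SL2)

text \<open>The parameter \<open>t\<close> of a diagonal element sits in the lower right corner, so that the \<open>n\<close>-th
  power of \<open>alpha0\<close> has the parameter of valuation \<open>n\<close>.\<close>

definition diag :: "'f::field \<Rightarrow> 'f ^ 2 ^ 2" where
  "diag t = mat2 (inverse t) 0 0 t"

definition upper :: "'f::field \<Rightarrow> 'f ^ 2 ^ 2" where
  "upper b = mat2 1 b 0 1"

definition lower :: "'f::field \<Rightarrow> 'f ^ 2 ^ 2" where
  "lower c = mat2 1 0 c 1"

lemma det_diag [simp]: "t \<noteq> 0 \<Longrightarrow> det (diag t) = 1"
  and det_upper [simp]: "det (upper b) = 1"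
  and det_lower [simp]: "det (lower b) = 1"
  by (simp_all add: diag_def upper_def lower_def)

lemma alpha0_diag: "alpha0 \<pi> = diag \<pi>"
  by (simp add: alpha0_def diag_def)

lemma inv_diag: "t \<noteq> 0 \<Longrightarrow> inv\<^bsub>SL2\<^esub> (diag t) = diag (inverse t)"
  by (simp add: diag_def inv_SL2)

lemma diag_mult: "diag s ** diag t = diag (s * t)"
  by (simp add: diag_def)

lemma alpha0_int_pow:
  assumes "\<pi> \<noteq> (0::'f::field)"
  shows "alpha0 \<pi> [^]\<^bsub>SL2\<^esub> (n::int) = diag (\<pi> powi n)"
proof -
  interpret group "SL2 :: ('f ^ 2 ^ 2) monoid"
    by (rule SL2_group)
  have nat: "alpha0 \<pi> [^]\<^bsub>SL2\<^esub> (m::nat) = diag (\<pi> ^ m)" for m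
  proof (induction m)
    case 0
    then show ?case
      by (simp add: one_SL2 mat_1_mat2 diag_def)
  next
    case (Suc m)
    then show ?case
      by (simp add: alpha0_diag diag_mult mult.commute)
  qed
  show ?thesis
  proof (cases n rule: int_cases2)
    case (nonneg m)
    then show ?thesis
      using nat[of m] by (simp add: int_pow_int)
  next
    case (nonpos m)
    have "alpha0 \<pi> \<in> carrier SL2"
      using assms by (simp add: alpha0_diag)
    then have "alpha0 \<pi> [^]\<^bsub>SL2\<^esub> (- int m) = inv\<^bsub>SL2\<^esub> (diag (\<pi> ^ m))"
      using nat[of m] int_pow_neg[of "alpha0 \<pi>" "int m"] by (simp only: int_pow_int)
    then show ?thesis
      using nonpos assms by (simp only: inv_diag power_int_minus power_int_of_nat) (simp add: inv_diag)
  qed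
qed


section \<open>Symmetric powers\<close>

text \<open>The polynomial \<open>P\<close> stands for the binary form of degree \<open>n\<close> that becomes \<open>P\<close> when its first
  variable is set to \<open>1\<close>; the form is evaluated at two polynomials.\<close>

definition eval_form :: "nat \<Rightarrow> 'a::comm_ring_1 poly \<Rightarrow> 'a poly \<Rightarrow> 'a poly \<Rightarrow> 'a poly" where
  "eval_form n P u w = (\<Sum>j\<le>n. Polynomial.smult (poly.coeff P j) (u ^ (n - j) * w ^ j))"

text \<open>Evaluation of forms is multiplicative; multiplying by one linear form at a time suffices for the
  products of powers of linear forms that define the action on a symmetric power.\<close>

lemma eval_form_linear_mult:
  assumes "Polynomial.degree Q \<le> n"
  shows "eval_form (Suc n) ([:a, c:] * Q) u w = (Polynomial.smult a u + Polynomial.smult c w) * eval_form n Q u w"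
proof -
  have Q: "poly.coeff Q (Suc n) = 0"
    using assms by (simp add: coeff_eq_0)
  have "eval_form (Suc n) ([:a, c:] * Q) u w =
      (\<Sum>j\<le>Suc n. Polynomial.smult (a * poly.coeff Q j) (u ^ (Suc n - j) * w ^ j)) +
      (\<Sum>j\<le>Suc n. Polynomial.smult (poly.coeff (pCons 0 (Polynomial.smult c Q)) j) (u ^ (Suc n - j) * w ^ j))"
    by (simp add: eval_form_def smult_add_left sum.distrib)
  also have "(\<Sum>j\<le>Suc n. Polynomial.smult (a * poly.coeff Q j) (u ^ (Suc n - j) * w ^ j)) =
      Polynomial.smult a u * eval_form n Q u w"
    unfolding eval_form_def sum_distrib_left sum.atMost_Suc
    using Q by (auto intro!: sum.cong simp: Suc_diff_le mult_ac)
  also have "(\<Sum>j\<le>Suc n. Polynomial.smult (poly.coeff (pCons 0 (Polynomial.smult c Q)) j) (u ^ (Suc n - j) * w ^ j)) =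
      Polynomial.smult c w * eval_form n Q u w"
    unfolding eval_form_def sum_distrib_left sum.atMost_Suc_shift
    by (auto intro!: sum.cong simp: mult_ac)
  finally show ?thesis
    by (simp add: distrib_right)
qed

lemma degree_linear_power_mult: "Polynomial.degree ([:a, c:] ^ m * [:b, d:] ^ l) \<le> m + l"
  for a :: "'a::comm_ring_1"
proof -
  have "Polynomial.degree ([:x, y:] ^ k) \<le> k" for x y :: 'a and k
    using degree_power_le[of "[:x, y:]" k] degree_pCons_le[of x "[:y:]"]
    by (metis degree_pCons_0 le_trans mult_le_mono1 nat_mult_1 One_nat_def)
  then show ?thesis
    by (meson add_le_mono degree_mult_le le_trans)
qed

lemma eval_form_linear_powers:
  "eval_form (m + l) ([:a, c:] ^ m * [:b, d:] ^ l) u w =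
    (Polynomial.smult a u + Polynomial.smult c w) ^ m * (Polynomial.smult b u + Polynomial.smult d w) ^ l"
proof (induction m)
  case 0
  show ?case
  proof (induction l)
    case 0
    then show ?case
      by (simp add: eval_form_def)
  next
    case (Suc l)
    then show ?case
      using eval_form_linear_mult[of "[:b, d:] ^ l" l b d u w]
        degree_linear_power_mult[of 0 0 0 b d l]
      by (simp add: mult_ac)
  qed
next
  case (Suc m)
  show ?case
    unfolding add_Suc power_Suc mult.assoc
      eval_form_linear_mult[OF degree_linear_power_mult, of m l a c a c b d u w] Suc ..
qed

text \<open>The action of \<open>A ** B\<close> on a monomial substitutes the columns of \<open>A\<close> into the form that \<open>B\<close>
  makes of it.\<close>

lemma sym_coeff_mult:
  fixes A B :: "'k::field ^ 2 ^ 2"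
  assumes "l \<le> n"
  shows "sym_coeff n (A ** B) m l = (\<Sum>j\<le>n. sym_coeff n A m j * sym_coeff n B j l)"
proof -
  obtain a b c d a' b' c' d' where AB: "A = mat2 a b c d" "B = mat2 a' b' c' d'"
    by (metis mat2_cases)
  have "[:a * a' + b * c', c * a' + d * c':] = Polynomial.smult a' [:a, c:] + Polynomial.smult c' [:b, d:]"
    "[:a * b' + b * d', c * b' + d * d':] = Polynomial.smult b' [:a, c:] + Polynomial.smult d' [:b, d:]"
    by (simp_all add: mult.commute)
  then have "sym_coeff n (A ** B) m l =
      poly.coeff (eval_form n ([:a', c':] ^ (n - l) * [:b', d':] ^ l) [:a, c:] [:b, d:]) m"
    using eval_form_linear_powers[of "n - l" l a' c' b' d' "[:a, c:]" "[:b, d:]"] assms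
    by (simp only: AB mat2_mult sym_coeff_def mat2_nth) simp
  also have "\<dots> = (\<Sum>j\<le>n. sym_coeff n A m j * sym_coeff n B j l)"
    by (simp add: eval_form_def coeff_sum sym_coeff_def AB mult.commute)
  finally show ?thesis .
qed

lemma sym_coeff_1: "l \<le> n \<Longrightarrow> sym_coeff n (mat 1 :: 'k::field ^ 2 ^ 2) m l = (if m = l then 1 else 0)"
proof -
  have "[:0, 1::'k:] ^ l = Polynomial.monom 1 l"
    by (simp add: monom_altdef)
  then show ?thesis
    by (simp add: sym_coeff_def mat_1_mat2 flip: one_pCons)
qed

lemma coeff_linear_power_top: "poly.coeff ([:a, c:] ^ n) n = c ^ n" for a :: "'a::comm_ring_1"
  by (simp add: coeff_linear_poly_power)

lemma coeff_const_power: "poly.coeff ([:a:] ^ n) m = (if m = 0 then a ^ n else 0)"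
  for a :: "'a::comm_ring_1"
proof -
  have "[:a:] ^ n = [:a ^ n:]"
    by (induction n) (simp_all add: one_pCons)
  then show ?thesis
    by (cases m) simp_all
qed

lemma coeff_monom_power: "poly.coeff ([:0, c:] ^ n) m = (if m = n then c ^ n else 0)"
  for c :: "'a::comm_ring_1"
proof -
  have "[:0, c:] ^ n = Polynomial.monom (c ^ n) n"
    by (induction n) (simp_all add: monom_Suc monom_0 one_pCons smult_monom)
  then show ?thesis
    by simp
qed


section \<open>Tensor products of symmetric powers\<close>

lemma finite_multi_indices: "finite (multi_indices e r)"
  unfolding multi_indices_def by (intro finite_PiE) auto

lemma multi_indices_le: "l \<in> multi_indices e r \<Longrightarrow> i < e \<Longrightarrow> l i \<le> r i"
  by (auto simp: multi_indices_def)

lemma tensor_map_in_weight [simp]: "tensor_map e r T x \<in> weight e r"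
  by (simp add: tensor_map_def weight_def)

lemma pure_tensor_in_weight [simp]: "pure_tensor e r x \<in> weight e r"
  by (simp add: pure_tensor_def weight_def)

lemma tensor_map_zero [simp]: "tensor_map e r T 0 = 0"
  by (rule ext) (simp add: tensor_map_def)

lemma tensor_map_add: "tensor_map e r T (x + y) = tensor_map e r T x + tensor_map e r T y"
  by (rule ext) (simp add: tensor_map_def distrib_left sum.distrib)

lemma tensor_map_scale: "tensor_map e r T (\<lambda>l. c * x l) = (\<lambda>l. c * tensor_map e r T x l)"
  by (rule ext) (simp add: tensor_map_def sum_distrib_left mult_ac)

lemma tensor_map_cong:
  assumes "\<And>i m l. i < e \<Longrightarrow> m \<le> r i \<Longrightarrow> l \<le> r i \<Longrightarrow> S i m l = T i m l"
  shows "tensor_map e r S x = tensor_map e r T x"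
  unfolding tensor_map_def using assms multi_indices_le
  by (intro ext if_cong refl sum.cong arg_cong2[where f = "(*)"] prod.cong) auto

lemma tensor_map_comp:
  "tensor_map e r S (tensor_map e r T x) =
    tensor_map e r (\<lambda>i m l. \<Sum>j\<le>r i. S i m j * T i j l) x"
proof (rule ext)
  fix m
  let ?M = "multi_indices e r"
  have "(\<Sum>l\<in>?M. (\<Prod>i<e. S i (m i) (l i)) * tensor_map e r T x l) =
      (\<Sum>l\<in>?M. \<Sum>l'\<in>?M. (\<Prod>i<e. S i (m i) (l i) * T i (l i) (l' i)) * x l')"
    by (intro sum.cong) (simp_all add: tensor_map_def sum_distrib_left prod.distrib mult_ac)
  also have "\<dots> = (\<Sum>l'\<in>?M. (\<Sum>l\<in>?M. \<Prod>i<e. S i (m i) (l i) * T i (l i) (l' i)) * x l')"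
    by (subst sum.swap) (simp add: sum_distrib_right)
  also have "\<dots> = (\<Sum>l'\<in>?M. (\<Prod>i<e. \<Sum>j\<le>r i. S i (m i) j * T i j (l' i)) * x l')"
    by (simp add: multi_indices_def prod_sum_PiE)
  finally show "tensor_map e r S (tensor_map e r T x) m =
      tensor_map e r (\<lambda>i m l. \<Sum>j\<le>r i. S i m j * T i j l) x m"
    by (simp add: tensor_map_def[of e r S] tensor_map_def[of e r "\<lambda>i m l. \<Sum>j\<le>r i. S i m j * T i j l"])
qed

lemma tensor_map_pure_tensor:
  "tensor_map e r T (pure_tensor e r x) = pure_tensor e r (\<lambda>i m. \<Sum>j\<le>r i. T i m j * x i j)"
proof (rule ext)
  fix m
  have "(\<Sum>l\<in>multi_indices e r. (\<Prod>i<e. T i (m i) (l i)) * pure_tensor e r x l) =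
      (\<Sum>l\<in>multi_indices e r. \<Prod>i<e. T i (m i) (l i) * x i (l i))"
    by (intro sum.cong) (simp_all add: pure_tensor_def prod.distrib)
  also have "\<dots> = (\<Prod>i<e. \<Sum>j\<le>r i. T i (m i) j * x i j)"
    by (simp add: multi_indices_def prod_sum_PiE)
  finally show "tensor_map e r T (pure_tensor e r x) m =
      pure_tensor e r (\<lambda>i m. \<Sum>j\<le>r i. T i m j * x i j) m"
    by (simp add: tensor_map_def pure_tensor_def)
qed

lemma tensor_map_id:
  assumes "x \<in> weight e r"
  shows "tensor_map e r (\<lambda>i m l. if m = l then 1 else 0) x = x"
proof (rule ext)
  fix m
  have "(\<Prod>i<e. if m i = l i then 1 else 0 :: 'a) = (if m = l then 1 else 0)"
    if "m \<in> multi_indices e r" "l \<in> multi_indices e r" for l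
  proof (cases "m = l")
    case False
    have "m = l" if "\<forall>i<e. m i = l i"
      using that \<open>m \<in> _\<close> \<open>l \<in> _\<close> unfolding multi_indices_def by (intro PiE_ext) auto
    with False obtain i where "i < e" "m i \<noteq> l i"
      by blast
    then show ?thesis
      using False by (auto intro!: prod_zero)
  qed simp
  then show "tensor_map e r (\<lambda>i m l. if m = l then 1 else 0) x m = x m"
    using assms finite_multi_indices[of e r]
    by (simp add: tensor_map_def weight_def if_distrib[of "\<lambda>c. c * _"] cong: if_cong)
qed

lemma pure_tensor_cong:
  assumes "\<And>i m. i < e \<Longrightarrow> m \<le> r i \<Longrightarrow> x i m = y i m"
  shows "pure_tensor e r x = pure_tensor e r y"
  unfolding pure_tensor_def using assms multi_indices_le by (intro ext if_cong refl prod.cong) auto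

lemma pure_tensor_scale:
  "pure_tensor e r (\<lambda>i m. c i * x i m) = (\<lambda>l. (\<Prod>i<e. c i) * pure_tensor e r x l)"
  by (rule ext) (simp add: pure_tensor_def prod.distrib)


section \<open>The action on weights\<close>

locale weight_setting = residue_setting v \<pi> \<iota> p e
  for v :: "'f::field \<Rightarrow> int" and \<pi> and \<iota> :: "'f set \<Rightarrow> 'k::field" and p e +
  fixes r :: "nat \<Rightarrow> nat"
begin

abbreviation act :: "'f ^ 2 ^ 2 \<Rightarrow> 'k wt \<Rightarrow> 'k wt" where
  "act \<equiv> weight_act v \<iota> p e r"

lemma mem_K0: "mat2 a b c d \<in> K0 v \<longleftrightarrow>
    a * d - b * c = 1 \<and> a \<in> val_ideal v 0 \<and> b \<in> val_ideal v 0 \<and> c \<in> val_ideal v 0 \<and> d \<in> val_ideal v 0"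
  by (simp add: K0_def forall_2)

lemma K0_det: "k \<in> K0 v \<Longrightarrow> det k = 1"
  by (simp add: K0_def)

lemma K0_mult:
  assumes "k \<in> K0 v" "k' \<in> K0 v"
  shows "k ** k' \<in> K0 v"
proof -
  have "det (k ** k') = 1"
    using assms by (simp add: K0_det det_mul)
  then show ?thesis
    using assms
    by (auto simp: K0_def forall_2 matrix_matrix_mult_def sum_2 intro!: ideal_add ideal_mult_0)
qed

lemma K0_inv:
  assumes "k \<in> K0 v"
  shows "inv\<^bsub>SL2\<^esub> k \<in> K0 v"
proof -
  obtain a b c d where k: "k = mat2 a b c d"
    by (rule mat2_cases)
  show ?thesis
    using assms by (simp add: k mem_K0 inv_SL2 mult.commute)
qed

text \<open>The matrix that acts on the \<open>i\<close>-th factor. Entrywise Frobenius is a ring homomorphism, so this is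
  multiplicative on \<open>K\<^sub>0\<close>.\<close>

definition twist :: "nat \<Rightarrow> 'f ^ 2 ^ 2 \<Rightarrow> 'k ^ 2 ^ 2" where
  "twist i k = (\<chi> a b. red (k $ a $ b) ^ p ^ i)"

lemma twist_mat2: "twist i (mat2 a b c d) =
    mat2 (red a ^ p ^ i) (red b ^ p ^ i) (red c ^ p ^ i) (red d ^ p ^ i)"
  by (simp add: twist_def mat2_eq_iff)

lemma act_eq: "act k = tensor_map e r (\<lambda>i. sym_coeff (r i) (twist i k))"
  by (simp add: weight_act_def twist_def reduce_def red_def)

lemma frobenius_add: "(x + y) ^ p ^ i = x ^ p ^ i + y ^ p ^ i" for x y :: 'k
  using freshmans_dream'[of "p ^ i" i x y] prime by (simp add: char)

lemma twist_mult:
  assumes "k \<in> K0 v" "k' \<in> K0 v"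
  shows "twist i (k ** k') = twist i k ** twist i k'"
proof -
  obtain a b c d a' b' c' d' where k: "k = mat2 a b c d" "k' = mat2 a' b' c' d'"
    by (metis mat2_cases)
  show ?thesis
    using assms
    by (simp add: k mem_K0 twist_mat2 red_add red_mult ideal_mult_0 frobenius_add power_mult_distrib)
qed

lemma act_mult:
  assumes "k \<in> K0 v" "k' \<in> K0 v"
  shows "act (k ** k') x = act k (act k' x)"
  unfolding act_eq tensor_map_comp
  by (rule tensor_map_cong) (simp add: twist_mult[OF assms] sym_coeff_mult)

lemma act_1:
  assumes "x \<in> weight e r"
  shows "act (mat 1) x = x"
proof -
  have "p > 0"
    using prime prime_gt_0_nat by blast
  then have "twist i (mat 1) = mat 1" for i
    by (simp add: mat_1_mat2 twist_mat2)
  then have "act (mat 1) x = tensor_map e r (\<lambda>i m l. if m = l then 1 else 0) x"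
    unfolding act_eq by (intro tensor_map_cong) (simp add: sym_coeff_1)
  also have "\<dots> = x"
    using assms by (rule tensor_map_id)
  finally show ?thesis .
qed

lemma act_in_weight [simp]: "act k x \<in> weight e r"
  by (simp add: act_eq)

abbreviation vec_X :: "'k wt" where
  "vec_X \<equiv> weight_vec e r"

text \<open>The lowest weight vector, a tensor product of powers of \<open>Y\<close>.\<close>

definition vec_Y :: "'k wt" where
  "vec_Y = pure_tensor e r (\<lambda>i l. if l = r i then 1 else 0)"

lemma vec_X_in_weight [simp]: "vec_X \<in> weight e r"
  and vec_Y_in_weight [simp]: "vec_Y \<in> weight e r"
  by (simp_all add: weight_vec_def vec_Y_def)

lemma U_op_in_weight [simp]: "U_op e r x \<in> weight e r"
  by (simp add: U_op_def)

text \<open>The character of the multiplicative monoid through which the diagonal torus acts on the two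
  extreme vectors; it is \<open>x \<mapsto> x ^ (\<Sum>i<e. r i * p ^ i)\<close> on residues, with \<open>0 ^ 0 = 1\<close>.\<close>

definition \<chi>r :: "'f \<Rightarrow> 'k" where
  "\<chi>r x = (\<Prod>i<e. (red x ^ p ^ i) ^ r i)"

lemma chi_mult: "x \<in> val_ideal v 0 \<Longrightarrow> y \<in> val_ideal v 0 \<Longrightarrow> \<chi>r (x * y) = \<chi>r x * \<chi>r y"
  by (simp add: \<chi>r_def red_mult power_mult_distrib prod.distrib)

lemma chi_1 [simp]: "\<chi>r 1 = 1"
  by (simp add: \<chi>r_def)

lemma chi_cong: "x - y \<in> val_ideal v 1 \<Longrightarrow> \<chi>r x = \<chi>r y"
  by (simp add: \<chi>r_def red_def flip: residue_class_eq_iff)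

lemma chi_trivial: "\<forall>i<e. r i = 0 \<Longrightarrow> \<chi>r x = 1"
  by (simp add: \<chi>r_def)

lemma chi_maximal_ideal:
  assumes "x \<in> val_ideal v 1" "\<not> (\<forall>i<e. r i = 0)"
  shows "\<chi>r x = 0"
proof -
  have "p > 0"
    using prime prime_gt_0_nat by blast
  moreover have "red x = 0"
    using assms(1) red_eq_0_iff ideal_mono[OF assms(1), of 0] by simp
  ultimately show ?thesis
    using assms(2) by (auto simp: \<chi>r_def intro!: prod_zero)
qed

lemma tensor_map_vec_X:
  "tensor_map e r T vec_X = pure_tensor e r (\<lambda>i m. T i m 0)"
  by (simp add: weight_vec_def tensor_map_pure_tensor if_distrib[of "\<lambda>c. _ * c"] cong: if_cong)

lemma tensor_map_vec_Y:
  "tensor_map e r T vec_Y = pure_tensor e r (\<lambda>i m. T i m (r i))"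
  by (simp add: vec_Y_def tensor_map_pure_tensor if_distrib[of "\<lambda>c. _ * c"] cong: if_cong)

lemma twist_entries: "twist i k $ a $ b = red (k $ a $ b) ^ p ^ i"
  by (simp add: twist_def)

lemma red_zero_power: "x \<in> val_ideal v 1 \<Longrightarrow> red x ^ p ^ i = 0"
  using red_eq_0_iff[of x] ideal_mono[of x 1 0] prime prime_gt_0_nat[of p] by simp

text \<open>A matrix entry that vanishes modulo \<open>\<p>\<close> turns the linear form \<open>aX + cY\<close> or \<open>bX + dY\<close> into a
  multiple of \<open>X\<close> or \<open>Y\<close>, so an extreme vector goes to a multiple of an extreme vector.\<close>

lemma act_vec_X_upper:
  assumes "k $ 2 $ 1 \<in> val_ideal v 1"
  shows "act k vec_X = (\<lambda>l. \<chi>r (k $ 1 $ 1) * vec_X l)"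
  unfolding act_eq tensor_map_vec_X \<chi>r_def
  unfolding weight_vec_def pure_tensor_scale[symmetric]
  by (rule pure_tensor_cong)
    (simp add: sym_coeff_def twist_entries red_zero_power[OF assms] coeff_const_power)

lemma act_vec_X_antidiagonal:
  assumes "k $ 1 $ 1 \<in> val_ideal v 1"
  shows "act k vec_X = (\<lambda>l. \<chi>r (k $ 2 $ 1) * vec_Y l)"
  unfolding act_eq tensor_map_vec_X \<chi>r_def
  unfolding vec_Y_def pure_tensor_scale[symmetric]
  by (rule pure_tensor_cong)
    (simp add: sym_coeff_def twist_entries red_zero_power[OF assms] coeff_monom_power)

lemma act_vec_Y_lower:
  assumes "k $ 1 $ 2 \<in> val_ideal v 1"
  shows "act k vec_Y = (\<lambda>l. \<chi>r (k $ 2 $ 2) * vec_Y l)"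
  unfolding act_eq tensor_map_vec_Y \<chi>r_def
  unfolding vec_Y_def pure_tensor_scale[symmetric]
  by (rule pure_tensor_cong)
    (simp add: sym_coeff_def twist_entries red_zero_power[OF assms] coeff_monom_power)

lemma act_vec_Y_antidiagonal:
  assumes "k $ 2 $ 2 \<in> val_ideal v 1"
  shows "act k vec_Y = (\<lambda>l. \<chi>r (k $ 1 $ 2) * vec_X l)"
  unfolding act_eq tensor_map_vec_Y \<chi>r_def
  unfolding weight_vec_def pure_tensor_scale[symmetric]
  by (rule pure_tensor_cong)
    (simp add: sym_coeff_def twist_entries red_zero_power[OF assms] coeff_const_power)

text \<open>The operator \<open>U\<close> only keeps the coefficient of the top power of \<open>Y\<close> in each factor, which is a
  power of a single matrix entry.\<close>

lemma U_act_vec_X: "U_op e r (act k vec_X) = (\<lambda>l. \<chi>r (k $ 2 $ 1) * vec_Y l)"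
  unfolding act_eq tensor_map_vec_X \<chi>r_def U_op_def tensor_map_pure_tensor
  unfolding vec_Y_def pure_tensor_scale[symmetric]
  by (rule pure_tensor_cong)
    (auto simp: sym_coeff_def twist_entries coeff_linear_power_top if_distrib[of "\<lambda>c. c * _"]
      cong: if_cong conj_cong)

lemma U_act_vec_Y: "U_op e r (act k vec_Y) = (\<lambda>l. \<chi>r (k $ 2 $ 2) * vec_Y l)"
  unfolding act_eq tensor_map_vec_Y \<chi>r_def U_op_def tensor_map_pure_tensor
  unfolding vec_Y_def pure_tensor_scale[symmetric]
  by (rule pure_tensor_cong)
    (auto simp: sym_coeff_def twist_entries coeff_linear_power_top if_distrib[of "\<lambda>c. c * _"]
      cong: if_cong conj_cong)

lemma act_w0_vec_X: "act w0 vec_X = vec_Y"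
  using act_vec_X_antidiagonal[of w0] by (simp add: w0_def)

lemma act_w0_vec_Y: "act w0 vec_Y = (\<lambda>l. \<chi>r (- 1) * vec_X l)"
  using act_vec_Y_antidiagonal[of w0] by (simp add: w0_def)

lemma act_scale: "act k (\<lambda>l. c * x l) = (\<lambda>l. c * act k x l)"
  by (simp add: act_eq tensor_map_scale)

lemma U_vec_Y: "U_op e r vec_Y = vec_Y"
  using U_act_vec_Y[of "mat 1"] by (simp add: act_1 mat_1_mat2[symmetric] del: mat_1_mat2) 
    (simp add: mat_1_mat2)

lemma vec_X_eq_vec_Y: "\<forall>i<e. r i = 0 \<Longrightarrow> vec_X = vec_Y"
  unfolding weight_vec_def vec_Y_def by (rule pure_tensor_cong) simp

lemma U_vec_X: "U_op e r vec_X = (if \<forall>i<e. r i = 0 then vec_Y else 0)"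
proof (cases "\<forall>i<e. r i = 0")
  case True
  then show ?thesis
    using U_vec_Y vec_X_eq_vec_Y by simp
next
  case False
  have "U_op e r vec_X = U_op e r (act (mat 1) vec_X)"
    by (simp add: act_1)
  also have "\<dots> = (\<lambda>l. \<chi>r 0 * vec_Y l)"
    unfolding U_act_vec_X by (simp add: mat_1_mat2)
  also have "\<dots> = 0"
    using chi_maximal_ideal[OF _ False, of 0] by (simp add: zero_fun_def)
  finally show ?thesis
    unfolding if_not_P[OF False] .
qed

lemma chi_minus_1_square: "\<chi>r (- 1) * \<chi>r (- 1) = 1"
  using chi_mult[of "- 1" "- 1"] by simp

text \<open>In the first family of the Hecke operator \<open>U\<close> projects to the line of \<open>Y\<close> and \<open>w\<^sub>0\<close> moves this
  line to that of \<open>X\<close>, so the coefficient is always a multiple of \<open>X\<close>.\<close>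

lemma hecke_coeff_vec_X: "act w0 (U_op e r (act (mat2 0 1 (- 1) A) vec_X)) = vec_X"
  by (simp add: U_act_vec_X act_scale act_w0_vec_Y mult.assoc[symmetric] chi_minus_1_square)

lemma hecke_coeff_vec_Y:
  assumes "A \<in> val_ideal v 0"
  shows "act w0 (U_op e r (act (mat2 0 1 (- 1) A) vec_Y)) = (\<lambda>l. \<chi>r (- A) * vec_X l)"
  using chi_mult[of A "- 1"] assms
  by (simp add: U_act_vec_Y act_scale act_w0_vec_Y mult.assoc[symmetric])

end


section \<open>Standard functions and the invariant functions\<close>

lemma sum_fun_apply: "(\<Sum>i\<in>S. f i) x = (\<Sum>i\<in>S. f i x)"
  by (induction S rule: infinite_finite_induct) auto

lemma scale_one [simp]: "scale 1 f = f"
  and scale_zero [simp]: "scale 0 f = 0"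
  by (simp_all add: scale_def fun_eq_iff)

lemma sum_const_ifun: "(\<Sum>i\<in>S. f) = scale (of_nat (card S)) f"
  by (simp add: scale_def fun_eq_iff sum_fun_apply)

lemma translate_sum: "translate g (\<Sum>i\<in>S. f i) = (\<Sum>i\<in>S. translate g (f i))"
  by (simp add: translate_def fun_eq_iff sum_fun_apply)

context weight_setting
begin

abbreviation std :: "'f ^ 2 ^ 2 \<Rightarrow> 'k wt \<Rightarrow> ('f, 'k) ifun" where
  "std \<equiv> std_fun v \<iota> p e r"

abbreviation Ind :: "('f, 'k) ifun set" where
  "Ind \<equiv> cind v \<iota> p e r"

lemma mem_K0_coset: "h \<in> K0 v #>\<^bsub>SL2\<^esub> g \<longleftrightarrow> (\<exists>k\<in>K0 v. h = k ** g)"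
  by (auto simp: r_coset_def)

lemma mem_K0_coset_inv:
  assumes "det g = 1"
  shows "h \<in> K0 v #>\<^bsub>SL2\<^esub> (inv\<^bsub>SL2\<^esub> g) \<longleftrightarrow> h ** g \<in> K0 v"
proof
  assume "h \<in> K0 v #>\<^bsub>SL2\<^esub> (inv\<^bsub>SL2\<^esub> g)"
  then obtain k where "k \<in> K0 v" "h = k ** inv\<^bsub>SL2\<^esub> g"
    by (auto simp: mem_K0_coset)
  then show "h ** g \<in> K0 v"
    by (simp add: matrix_mul_assoc[symmetric] SL2_inv_cancel[OF assms])
next
  assume "h ** g \<in> K0 v"
  moreover have "h = (h ** g) ** inv\<^bsub>SL2\<^esub> g"
    by (simp add: matrix_mul_assoc[symmetric] SL2_inv_cancel[OF assms])
  ultimately show "h \<in> K0 v #>\<^bsub>SL2\<^esub> (inv\<^bsub>SL2\<^esub> g)"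
    unfolding mem_K0_coset by blast
qed

lemma std_apply: "det g = 1 \<Longrightarrow> std g x h = (if h ** g \<in> K0 v then act (h ** g) x else 0)"
  by (simp add: std_fun_def mem_K0_coset_inv)

lemma K0_mult_right_iff:
  assumes "k \<in> K0 v"
  shows "h ** k \<in> K0 v \<longleftrightarrow> h \<in> K0 v"
proof
  assume "h ** k \<in> K0 v"
  then have "h ** k ** inv\<^bsub>SL2\<^esub> k \<in> K0 v"
    using K0_inv[OF assms] by (rule K0_mult)
  then show "h \<in> K0 v"
    by (simp add: matrix_mul_assoc[symmetric] SL2_inv_cancel K0_det[OF assms])
qed (use assms K0_mult in blast)

lemma K0_mult_left_iff:
  assumes "k \<in> K0 v"
  shows "k ** h \<in> K0 v \<longleftrightarrow> h \<in> K0 v"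
proof
  assume "k ** h \<in> K0 v"
  then have "inv\<^bsub>SL2\<^esub> k ** (k ** h) \<in> K0 v"
    by (rule K0_mult[OF K0_inv[OF assms]])
  then show "h \<in> K0 v"
    by (simp add: matrix_mul_assoc SL2_inv_cancel K0_det[OF assms])
qed (use assms K0_mult in blast)

text \<open>Standard functions only depend on the class of \<open>(g, x)\<close> in the quotient of \<open>SL\<^sub>2 \<times> \<sigma>\<close> by
  \<open>K\<^sub>0\<close>; all identities between them below come from this rule and a matrix identity.\<close>

lemma std_mult_K0:
  assumes "det g = 1" "k \<in> K0 v"
  shows "std (g ** k) x = std g (act k x)"
proof
  fix h
  have "std (g ** k) x h = (if h ** g \<in> K0 v then act (h ** g ** k) x else 0)"
    using assms by (simp add: std_apply det_mul K0_det matrix_mul_assoc K0_mult_right_iff)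
  then show "std (g ** k) x h = std g (act k x) h"
    using assms act_mult by (simp add: std_apply)
qed

lemma translate_std:
  assumes "det a = 1" "det g = 1"
  shows "translate a (std g x) = std (a ** g) x"
  using assms by (simp add: translate_def std_apply det_mul matrix_mul_assoc fun_eq_iff)

lemma act_zero [simp]: "act k 0 = 0"
  by (simp add: act_eq)

lemma std_zero [simp]: "std g 0 = 0"
  by (simp add: std_fun_def fun_eq_iff)

lemma act_eq_0_iff:
  assumes "k \<in> K0 v" "x \<in> weight e r"
  shows "act k x = 0 \<longleftrightarrow> x = 0"
proof
  assume "act k x = 0"
  then have "act (inv\<^bsub>SL2\<^esub> k ** k) x = 0"
    using assms K0_inv by (simp add: act_mult)
  then show "x = 0"
    using assms by (simp add: SL2_inv_cancel K0_det act_1)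
qed simp

text \<open>It suffices that finitely many cosets cover the support: by equivariance a function that is nonzero
  somewhere on a coset is nonzero everywhere on it.\<close>

lemma cindI:
  assumes outside: "\<And>g. det g \<noteq> 1 \<Longrightarrow> f g = 0"
    and weight: "\<And>g. det g = 1 \<Longrightarrow> f g \<in> weight e r"
    and equivariant: "\<And>k g. k \<in> K0 v \<Longrightarrow> det g = 1 \<Longrightarrow> f (k ** g) = act k (f g)"
    and fin: "finite T" and sub: "\<And>g. f g \<noteq> 0 \<Longrightarrow> \<exists>h\<in>T. \<exists>k\<in>K0 v. g = k ** h"
  shows "f \<in> Ind"
proof -
  let ?S = "{g \<in> T. f g \<noteq> 0}"
  have det: "det g = 1" if "f g \<noteq> 0" for g
    using that outside by blast
  have "{g. f g \<noteq> 0} = (\<Union>g\<in>?S. K0 v #>\<^bsub>SL2\<^esub> g)"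
  proof (intro equalityI subsetI)
    fix g assume g: "g \<in> {g. f g \<noteq> 0}"
    then obtain h k where hk: "h \<in> T" "k \<in> K0 v" "g = k ** h"
      using sub by blast
    have "det h = 1"
      using hk det[of g] g by (simp add: det_mul K0_det)
    then have "f h \<noteq> 0"
      using equivariant[OF hk(2), of h] g hk(3) by auto
    with hk show "g \<in> (\<Union>g\<in>?S. K0 v #>\<^bsub>SL2\<^esub> g)"
      unfolding UN_iff mem_K0_coset by blast
  next
    fix g assume "g \<in> (\<Union>g\<in>?S. K0 v #>\<^bsub>SL2\<^esub> g)"
    then obtain h k where hk: "f h \<noteq> 0" "k \<in> K0 v" "g = k ** h"
      unfolding UN_iff mem_K0_coset by blast
    then show "g \<in> {g. f g \<noteq> 0}"
      using equivariant[OF hk(2) det[OF hk(1)]] act_eq_0_iff weight det by simp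
  qed
  moreover have "finite ?S" "?S \<subseteq> carrier SL2"
    using fin det by (simp, force)
  ultimately have "\<exists>S. finite S \<and> S \<subseteq> carrier SL2 \<and> {g. f g \<noteq> 0} = (\<Union>g\<in>S. K0 v #>\<^bsub>SL2\<^esub> g)"
    by blast
  then show ?thesis
    using assms(1-3) by (simp add: cind_def)
qed

lemma cind_outside: "f \<in> Ind \<Longrightarrow> det g \<noteq> 1 \<Longrightarrow> f g = 0"
  and cind_weight: "f \<in> Ind \<Longrightarrow> det g = 1 \<Longrightarrow> f g \<in> weight e r"
  and cind_equivariant: "f \<in> Ind \<Longrightarrow> k \<in> K0 v \<Longrightarrow> det g = 1 \<Longrightarrow> f (k ** g) = act k (f g)"
  by (simp_all add: cind_def)

lemma cind_support:
  assumes "f \<in> Ind"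
  shows "\<exists>S. finite S \<and> (\<forall>g. f g \<noteq> 0 \<longrightarrow> (\<exists>h\<in>S. \<exists>k\<in>K0 v. g = k ** h))"
proof -
  obtain S where S: "finite S" "{g. f g \<noteq> 0} = (\<Union>g\<in>S. K0 v #>\<^bsub>SL2\<^esub> g)"
    using assms unfolding cind_def by blast
  have "\<exists>h\<in>S. \<exists>k\<in>K0 v. g = k ** h" if "f g \<noteq> 0" for g
  proof -
    have "g \<in> (\<Union>g\<in>S. K0 v #>\<^bsub>SL2\<^esub> g)"
      using that S(2) by blast
    then show ?thesis
      by (simp add: mem_K0_coset)
  qed
  with S(1) show ?thesis
    by blast
qed

lemma std_in_Ind:
  assumes "det g = 1" "x \<in> weight e r"
  shows "std g x \<in> Ind"
proof (rule cindI)
  fix h :: "'f ^ 2 ^ 2" assume "det h \<noteq> 1"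
  then have "h ** g \<notin> K0 v"
    using assms K0_det[of "h ** g"] by (auto simp: det_mul)
  then show "std g x h = 0"
    using assms by (simp add: std_apply)
next
  fix h :: "'f ^ 2 ^ 2"
  show "std g x h \<in> weight e r"
    using act_in_weight[of "h ** g" x] assms(1) by (simp add: std_apply weight_def)
next
  fix k h :: "'f ^ 2 ^ 2" assume "k \<in> K0 v"
  then show "std g x (k ** h) = act k (std g x h)"
    using assms by (simp add: std_apply matrix_mul_assoc[symmetric] K0_mult_left_iff act_mult)
next
  fix h assume "std g x h \<noteq> 0"
  then have "h ** g \<in> K0 v"
    using assms by (auto simp: std_apply split: if_splits)
  moreover have "h = h ** g ** inv\<^bsub>SL2\<^esub> g"
    using assms by (simp add: matrix_mul_assoc[symmetric] SL2_inv_cancel)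
  ultimately show "\<exists>h'\<in>{inv\<^bsub>SL2\<^esub> g}. \<exists>k\<in>K0 v. h = k ** h'"
    by blast
qed simp

lemma zero_in_Ind: "0 \<in> Ind"
  by (rule cindI[where T = "{}"]) (simp_all add: weight_def)

lemma add_in_Ind:
  assumes "f \<in> Ind" "f' \<in> Ind"
  shows "f + f' \<in> Ind"
proof -
  obtain S where S: "finite S" "\<And>g. f g \<noteq> 0 \<Longrightarrow> \<exists>h\<in>S. \<exists>k\<in>K0 v. g = k ** h"
    using cind_support[OF assms(1)] by blast
  obtain S' where S': "finite S'" "\<And>g. f' g \<noteq> 0 \<Longrightarrow> \<exists>h\<in>S'. \<exists>k\<in>K0 v. g = k ** h"
    using cind_support[OF assms(2)] by blast
  show ?thesis
  proof (rule cindI[where T = "S \<union> S'"])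
    fix g assume "(f + f') g \<noteq> 0"
    then have "f g \<noteq> 0 \<or> f' g \<noteq> 0"
      by auto
    then show "\<exists>h\<in>S \<union> S'. \<exists>k\<in>K0 v. g = k ** h"
      using S(2) S'(2) by blast
  next
    fix g :: "'f ^ 2 ^ 2" assume "det g = 1"
    then have "f g \<in> weight e r" "f' g \<in> weight e r"
      using cind_weight assms by blast+
    then show "(f + f') g \<in> weight e r"
      by (simp add: weight_def)
  next
    fix k g :: "'f ^ 2 ^ 2" assume "k \<in> K0 v" "det g = 1"
    then show "(f + f') (k ** g) = act k ((f + f') g)"
      using cind_equivariant assms by (simp add: act_eq tensor_map_add)
  qed (use S S' cind_outside assms in auto)
qed

lemma sum_in_Ind: "(\<And>i. i \<in> S \<Longrightarrow> f i \<in> Ind) \<Longrightarrow> (\<Sum>i\<in>S. f i) \<in> Ind"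
  by (induction S rule: infinite_finite_induct) (auto intro: zero_in_Ind add_in_Ind)

text \<open>An invariant function is determined by its value at a single point of the double coset that
  carries it.\<close>

lemma inv_fun_eqI:
  assumes f: "f \<in> Ind" and inv: "\<And>g. g \<in> IS1 v \<Longrightarrow> translate g f = f"
    and supp: "\<And>x. f x \<noteq> 0 \<Longrightarrow> \<exists>k\<in>K0 v. \<exists>g\<in>IS1 v. x = k ** diag (\<pi> powi (- n)) ** g"
    and at: "f (diag (\<pi> powi (- n))) = (if n > 0 then vec_Y else vec_X)"
  shows "inv_fun v \<pi> \<iota> p e r n = f"
proof -
  let ?P = "\<lambda>f. f \<in> Ind \<and> (\<forall>g\<in>IS1 v. translate g f = f) \<and>
    {x. f x \<noteq> 0} \<subseteq> {k ** (alpha0 \<pi> [^]\<^bsub>SL2\<^esub> (- n)) ** g | k g. k \<in> K0 v \<and> g \<in> IS1 v} \<and>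
    f (alpha0 \<pi> [^]\<^bsub>SL2\<^esub> (- n)) = (if n > 0 then act w0 vec_X else vec_X)"
  have "?P f"
    using f inv supp at unfolding alpha0_int_pow[OF uniformizer_nonzero] act_w0_vec_X by blast
  moreover have "f' = f" if P: "?P f'" for f'
  proof
    fix x
    have supp': "\<exists>k\<in>K0 v. \<exists>g\<in>IS1 v. x = k ** diag (\<pi> powi (- n)) ** g" if "f' x \<noteq> 0"
      using that P unfolding alpha0_int_pow[OF uniformizer_nonzero] by blast
    show "f' x = f x"
    proof (cases "\<exists>k\<in>K0 v. \<exists>g\<in>IS1 v. x = k ** diag (\<pi> powi (- n)) ** g")
      case False
      then show ?thesis
        using supp supp' by metis
    next
      case True
      then obtain k g where x: "k \<in> K0 v" "g \<in> IS1 v" "x = k ** diag (\<pi> powi (- n)) ** g"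
        by blast
      have "F x = act k (if n > 0 then vec_Y else vec_X)"
        if F: "F \<in> Ind" "translate g F = F"
          "F (diag (\<pi> powi (- n))) = (if n > 0 then vec_Y else vec_X)" for F
      proof -
        have "F x = translate g F (k ** diag (\<pi> powi (- n)))"
          by (simp add: translate_def x(3))
        also have "\<dots> = act k (F (diag (\<pi> powi (- n))))"
          using F(1,2) cind_equivariant[OF F(1) x(1)] by simp
        finally show ?thesis
          by (simp only: F(3))
      qed
      note this[OF f inv[OF x(2)] at]
        this[of f'] P[unfolded alpha0_int_pow[OF uniformizer_nonzero] act_w0_vec_X]
      then show ?thesis
        using x(2) by metis
    qed
  qed
  ultimately show ?thesis
    unfolding inv_fun_def by (intro the_equality) blast+
qed

lemma IS1_mat2: "mat2 a b c d \<in> IS1 v \<longleftrightarrow> a * d - b * c = 1 \<and>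
    a - 1 \<in> val_ideal v 1 \<and> b \<in> val_ideal v 0 \<and> c \<in> val_ideal v 1 \<and> d - 1 \<in> val_ideal v 1"
  using one_unit(1)[of a] one_unit(1)[of d] ideal_mono[of c 1 0]
  by (auto simp: IS1_def mem_K0)

lemma upper_IS1: "b \<in> val_ideal v 0 \<Longrightarrow> upper b \<in> IS1 v"
  and lower_IS1: "c \<in> val_ideal v 1 \<Longrightarrow> lower c \<in> IS1 v"
  by (simp_all add: upper_def lower_def IS1_mat2)

text \<open>The permutation of \<open>\<p>\<^sup>m\<close> that describes how a pro-\<open>p\<close> Iwahori subgroup moves unipotent
  cosets; \<open>m = 0\<close> serves the upper and \<open>m = 1\<close> the lower triangular ones.\<close>

lemma sum_transversal_moebius:
  fixes F :: "'f \<Rightarrow> 'm::comm_monoid_add"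
  assumes det: "\<alpha> * \<delta> - \<beta> * \<gamma> = 1"
    and \<alpha>: "\<alpha> - 1 \<in> val_ideal v 1" and \<beta>: "\<beta> \<in> val_ideal v m"
    and \<gamma>: "\<gamma> \<in> val_ideal v (1 - m)" and \<delta>: "\<delta> - 1 \<in> val_ideal v 1"
    and R: "transversal m b R" and F: "periodic m b F"
  shows "(\<Sum>x\<in>R. F ((\<alpha> * x + \<beta>) / (\<gamma> * x + \<delta>))) = sum F R"
proof -
  have den: "\<gamma>' * x + \<delta>' - 1 \<in> val_ideal v 1"
    if "\<gamma>' \<in> val_ideal v (1 - m)" "\<delta>' - 1 \<in> val_ideal v 1" "x \<in> val_ideal v m" for \<gamma>' \<delta>' x
    using ideal_add[OF _ that(2)] ideal_mult[OF that(1,3)] by (simp add: add_diff_eq)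
  have frac: "(\<alpha>' * x + \<beta>') / (\<gamma>' * x + \<delta>') \<in> val_ideal v m"
    if "\<alpha>' - 1 \<in> val_ideal v 1" "\<beta>' \<in> val_ideal v m" "\<gamma>' \<in> val_ideal v (1 - m)"
      "\<delta>' - 1 \<in> val_ideal v 1" "x \<in> val_ideal v m" for \<alpha>' \<beta>' \<gamma>' \<delta>' x
  proof -
    have "\<alpha>' * x + \<beta>' \<in> val_ideal v m"
      using one_unit(1)[OF that(1)] that(2,5) by (intro ideal_add ideal_mult_0)
    then have "inverse (\<gamma>' * x + \<delta>') * (\<alpha>' * x + \<beta>') \<in> val_ideal v m"
      using ideal_scale_iff[of "inverse (\<gamma>' * x + \<delta>')" "\<alpha>' * x + \<beta>'" m]
        one_unit(3,4)[OF den[OF that(3-5)]] by (simp add: val_inverse)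
    then show ?thesis
      by (simp add: divide_inverse mult.commute)
  qed
  let ?\<phi> = "\<lambda>x. (\<alpha> * x + \<beta>) / (\<gamma> * x + \<delta>)"
  show ?thesis
  proof (rule sum_transversal_image[OF R R F])
    show "?\<phi> ` val_ideal v m = val_ideal v m"
    proof (intro equalityI subsetI)
      fix y assume y: "y \<in> val_ideal v m"
      define s where "s = - \<gamma> * y + \<alpha>"
      define x where "x = (\<delta> * y + - \<beta>) / s"
      have x: "x \<in> val_ideal v m"
        unfolding x_def s_def using \<alpha> \<beta> \<gamma> \<delta> y by (intro frac) auto
      have s: "s \<noteq> 0"
        using one_unit(3)[OF den[of "- \<gamma>" \<alpha> y]] \<gamma> \<alpha> y by (simp add: s_def)
      have xs: "x * s = \<delta> * y - \<beta>"
        using s by (simp add: x_def)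
      have "(\<alpha> * x + \<beta>) * s = \<alpha> * (x * s) + \<beta> * s"
        by (simp add: algebra_simps)
      also have "\<dots> = y * (\<alpha> * \<delta> - \<beta> * \<gamma>)"
        unfolding xs by (simp add: s_def algebra_simps)
      finally have num: "(\<alpha> * x + \<beta>) * s = y"
        by (simp only: det mult_1_right)
      have "(\<gamma> * x + \<delta>) * s = \<gamma> * (x * s) + \<delta> * s"
        by (simp add: algebra_simps)
      also have "\<dots> = \<alpha> * \<delta> - \<beta> * \<gamma>"
        unfolding xs by (simp add: s_def algebra_simps)
      finally have den: "(\<gamma> * x + \<delta>) * s = 1"
        by (simp only: det)
      have "?\<phi> x = ((\<alpha> * x + \<beta>) * s) / ((\<gamma> * x + \<delta>) * s)"
        using s by simp
      then have "?\<phi> x = y"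
        by (simp only: num den div_by_1)
      then show "y \<in> ?\<phi> ` val_ideal v m"
        using x by blast
    qed (use frac \<alpha> \<beta> \<gamma> \<delta> in blast)
  next
    fix x y assume xy: "x \<in> val_ideal v m" "y \<in> val_ideal v m"
    let ?D = "inverse ((\<gamma> * x + \<delta>) * (\<gamma> * y + \<delta>))"
    note ux = one_unit(3,4)[OF den[OF \<gamma> \<delta> xy(1)]] and uy = one_unit(3,4)[OF den[OF \<gamma> \<delta> xy(2)]]
    have D: "?D \<noteq> 0" "v ?D = 0"
      using ux uy by (simp_all add: val_inverse val_mult)
    have "?\<phi> x - ?\<phi> y = ?D * ((x - y) * (\<alpha> * \<delta> - \<beta> * \<gamma>))"
      using ux(1) uy(1) by (simp add: divide_simps) (simp add: algebra_simps)
    then have "?\<phi> x - ?\<phi> y = ?D * (x - y)"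
      by (simp only: det mult_1_right)
    then show "?\<phi> x - ?\<phi> y \<in> val_ideal v b \<longleftrightarrow> x - y \<in> val_ideal v b"
      using ideal_scale_iff[OF D(1), of "x - y" b] D(2) by simp
  qed
qed

lemma powi_minus: "\<pi> powi (- n) = inverse (\<pi> powi n)"
  by (rule power_int_minus)

lemma powi_nonzero [simp]: "\<pi> powi n \<noteq> 0"
  by simp

text \<open>The summands of the invariant functions: \<open>upper_fun n\<close> for \<open>n \<le> 0\<close>, \<open>lower_fun n\<close> for \<open>n > 0\<close>.\<close>

definition upper_fun :: "int \<Rightarrow> 'f \<Rightarrow> ('f, 'k) ifun" where
  "upper_fun n b = std (upper b ** diag (\<pi> powi n)) vec_X"

definition lower_fun :: "int \<Rightarrow> 'f \<Rightarrow> ('f, 'k) ifun" where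
  "lower_fun n c = std (lower c ** diag (\<pi> powi n)) vec_Y"

lemma upper_add: "upper a ** upper b = upper (a + b)"
  and lower_add: "lower a ** lower b = lower (a + b)"
  by (simp_all add: upper_def lower_def add.commute)

lemma diag_upper: "t \<noteq> 0 \<Longrightarrow> diag t ** upper b = upper (b / t\<^sup>2) ** diag t"
  and diag_lower: "t \<noteq> 0 \<Longrightarrow> diag t ** lower c = lower (c * t\<^sup>2) ** diag t"
  by (simp_all add: diag_def upper_def lower_def power2_eq_square field_simps)

lemma upper_K0: "b \<in> val_ideal v 0 \<Longrightarrow> upper b \<in> K0 v"
  and lower_K0: "c \<in> val_ideal v 0 \<Longrightarrow> lower c \<in> K0 v"
  by (simp_all add: upper_def lower_def mem_K0)

lemma act_upper_vec_X: "act (upper b) vec_X = vec_X"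
  and act_lower_vec_Y: "act (lower c) vec_Y = vec_Y"
  using act_vec_X_upper[of "upper b"] act_vec_Y_lower[of "lower c"]
  by (simp_all add: upper_def lower_def)

text \<open>Conjugation by the diagonal element moves a unipotent matrix with small entry into \<open>K\<^sub>0\<close>, where
  it fixes the extreme vector.\<close>

lemma periodic_upper_fun: "periodic m (- 2 * n) (upper_fun n)"
  unfolding periodic_def
proof (intro ballI impI)
  fix x y assume xy: "x - y \<in> val_ideal v (- 2 * n)"
  let ?t = "\<pi> powi n"
  have "?t\<^sup>2 * (x - y) \<in> val_ideal v 0"
    using xy ideal_scale_iff[of "?t\<^sup>2" "x - y" 0] by (simp add: val_power val_power_int)
  moreover have "upper x ** diag ?t = upper y ** diag ?t ** upper (?t\<^sup>2 * (x - y))"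
    by (simp add: matrix_mul_assoc[symmetric] diag_upper)
      (simp add: matrix_mul_assoc upper_add)
  ultimately show "upper_fun n x = upper_fun n y"
    by (simp add: upper_fun_def std_mult_K0 upper_K0 det_mul act_upper_vec_X)
qed

lemma periodic_lower_fun: "periodic m (2 * n) (lower_fun n)"
  unfolding periodic_def
proof (intro ballI impI)
  fix x y assume xy: "x - y \<in> val_ideal v (2 * n)"
  let ?t = "\<pi> powi n"
  have "inverse (?t\<^sup>2) * (x - y) \<in> val_ideal v 0"
    using xy ideal_scale_iff[of "inverse (?t\<^sup>2)" "x - y" 0]
    by (simp add: val_power val_power_int val_inverse)
  moreover have "lower x ** diag ?t = lower y ** diag ?t ** lower (inverse (?t\<^sup>2) * (x - y))"
  proof -
    have "inverse (?t\<^sup>2) * (x - y) * ?t\<^sup>2 = x - y"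
      by simp
    then have "diag ?t ** lower (inverse (?t\<^sup>2) * (x - y)) = lower (x - y) ** diag ?t"
      by (simp only: diag_lower[OF powi_nonzero])
    then show ?thesis
      by (simp only: matrix_mul_assoc[symmetric]) (simp add: matrix_mul_assoc lower_add)
  qed
  ultimately show "lower_fun n x = lower_fun n y"
    by (simp add: lower_fun_def std_mult_K0 lower_K0 det_mul act_lower_vec_Y)
qed

lemma upper_fun_in_Ind: "upper_fun n b \<in> Ind"
  and lower_fun_in_Ind: "lower_fun n b \<in> Ind"
  by (simp_all add: upper_fun_def lower_fun_def std_in_Ind det_mul)

lemma chi_one_unit: "x - 1 \<in> val_ideal v 1 \<Longrightarrow> \<chi>r x = 1"
  using chi_cong[of x 1] by simp

text \<open>Left multiplication by an element of the pro-\<open>p\<close> Iwahori subgroup changes the unipotent part by a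
  fractional linear map; the remaining triangular factor passes through the diagonal element into
  \<open>K\<^sub>0\<close> and fixes the extreme vector, as its diagonal entries are \<open>1\<close> modulo \<open>\<p>\<close>.\<close>

lemma translate_upper_fun:
  assumes g: "mat2 a b0 c d \<in> IS1 v" and n: "n \<le> 0" and b: "b \<in> val_ideal v 0"
  shows "translate (mat2 a b0 c d) (upper_fun n b) = upper_fun n ((a * b + b0) / (c * b + d))"
proof -
  let ?t = "\<pi> powi n" and ?s = "(a * b + b0) / (c * b + d)"
  have G: "a * d - b0 * c = 1" "a - 1 \<in> val_ideal v 1" "b0 \<in> val_ideal v 0"
    "c \<in> val_ideal v 1" "d - 1 \<in> val_ideal v 1"
    using g by (simp_all add: IS1_mat2)
  have z1: "(c * b + d) - 1 \<in> val_ideal v 1"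
    using ideal_add[OF ideal_mult_0'[OF G(4) b] G(5)] by (simp add: add_diff_eq)
  have z: "c * b + d \<noteq> 0" "v (c * b + d) = 0"
    using one_unit[OF z1] by auto
  have x: "a - ?s * c = inverse (c * b + d)"
    using G(1) z by (simp add: field_simps)
  let ?k = "mat2 (inverse (c * b + d)) 0 (c / ?t\<^sup>2) (c * b + d)"
  have "inverse (?t\<^sup>2) * c \<in> val_ideal v 1"
    using G(4) n ideal_scale_iff[of "inverse (?t\<^sup>2)" c 1] ideal_mono[of c 1 "1 + 2 * n"]
    by (simp add: val_power val_power_int val_inverse)
  then have c: "c / ?t\<^sup>2 \<in> val_ideal v 1"
    by (simp add: field_simps)
  have k: "?k \<in> K0 v"
    using z ideal_mono[OF c, of 0] by (simp add: mem_K0 in_ideal_iff val_inverse)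
  have "inverse (c * b + d) - 1 \<in> val_ideal v 1"
    using ideal_mult_0[of "inverse (c * b + d)" "1 - (c * b + d)" 1] z1 z
      ideal_diff_commute[of 1 "c * b + d" 1]
    by (simp add: in_ideal_iff val_inverse right_diff_distrib)
  then have kX: "act ?k vec_X = vec_X"
    using c act_vec_X_upper[of ?k] by (simp add: chi_one_unit)
  have "?s * (c * b + d) = a * b + b0"
    using z(1) by simp
  then have eq1: "mat2 a b0 c d ** upper b = upper ?s ** mat2 (a - ?s * c) 0 c (c * b + d)"
    by (simp only: upper_def mat2_mult mat2_inject) simp
  have eq2: "mat2 (a - ?s * c) 0 c (c * b + d) ** diag ?t = diag ?t ** ?k"
    unfolding x by (simp add: diag_def power2_eq_square field_simps)
  have "mat2 a b0 c d ** (upper b ** diag ?t) = upper ?s ** diag ?t ** ?k"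
    by (simp only: matrix_mul_assoc eq1) (simp only: matrix_mul_assoc[symmetric] eq2)
  moreover have "det (mat2 a b0 c d) = 1"
    using G(1) by simp
  ultimately show ?thesis
    using k kX by (simp add: upper_fun_def translate_std det_mul std_mult_K0 del: det_mat2)
qed

lemma translate_lower_fun:
  assumes g: "mat2 a b c0 d \<in> IS1 v" and n: "n > 0" and c: "c \<in> val_ideal v 1"
  shows "translate (mat2 a b c0 d) (lower_fun n c) = lower_fun n ((d * c + c0) / (b * c + a))"
proof -
  let ?t = "\<pi> powi n" and ?s = "(d * c + c0) / (b * c + a)"
  have G: "a * d - b * c0 = 1" "a - 1 \<in> val_ideal v 1" "b \<in> val_ideal v 0"
    "c0 \<in> val_ideal v 1" "d - 1 \<in> val_ideal v 1"
    using g by (simp_all add: IS1_mat2)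
  have z1: "(b * c + a) - 1 \<in> val_ideal v 1"
    using ideal_add[OF ideal_mult_0[OF G(3) c] G(2)] by (simp add: add_diff_eq)
  have z: "b * c + a \<noteq> 0" "v (b * c + a) = 0"
    using one_unit[OF z1] by auto
  have x: "d - ?s * b = inverse (b * c + a)"
    using G(1) z by (simp add: field_simps)
  let ?k = "mat2 (b * c + a) (b * ?t\<^sup>2) 0 (inverse (b * c + a))"
  have "?t\<^sup>2 * b \<in> val_ideal v 1"
    using G(3) n ideal_scale_iff[of "?t\<^sup>2" b 1] ideal_mono[of b 0 "1 - 2 * n"]
    by (simp add: val_power val_power_int)
  then have b: "b * ?t\<^sup>2 \<in> val_ideal v 1"
    by (simp add: mult.commute)
  have k: "?k \<in> K0 v"
    using z ideal_mono[OF b, of 0] by (simp add: mem_K0 in_ideal_iff val_inverse)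
  have "inverse (b * c + a) - 1 \<in> val_ideal v 1"
    using ideal_mult_0[of "inverse (b * c + a)" "1 - (b * c + a)" 1] z1 z
      ideal_diff_commute[of 1 "b * c + a" 1]
    by (simp add: in_ideal_iff val_inverse right_diff_distrib)
  then have kY: "act ?k vec_Y = vec_Y"
    using b act_vec_Y_lower[of ?k] by (simp add: chi_one_unit)
  have "?s * (b * c + a) = d * c + c0"
    using z(1) by simp
  then have eq1: "mat2 a b c0 d ** lower c = lower ?s ** mat2 (b * c + a) b 0 (d - ?s * b)"
    by (simp only: lower_def mat2_mult mat2_inject) (simp add: add.commute)
  have eq2: "mat2 (b * c + a) b 0 (d - ?s * b) ** diag ?t = diag ?t ** ?k"
    unfolding x by (simp add: diag_def power2_eq_square field_simps)
  have "mat2 a b c0 d ** (lower c ** diag ?t) = lower ?s ** diag ?t ** ?k"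
    by (simp only: matrix_mul_assoc eq1) (simp only: matrix_mul_assoc[symmetric] eq2)
  moreover have "det (mat2 a b c0 d) = 1"
    using G(1) by simp
  ultimately show ?thesis
    using k kY by (simp add: lower_fun_def translate_std det_mul std_mult_K0 del: det_mat2)
qed

lemma std_support:
  assumes "det u = 1" "det g = 1" "std (u ** g) x h \<noteq> 0"
  shows "\<exists>k\<in>K0 v. h = k ** inv\<^bsub>SL2\<^esub> g ** inv\<^bsub>SL2\<^esub> u"
proof -
  have "h ** (u ** g) \<in> K0 v"
    using assms by (auto simp: std_apply det_mul split: if_splits)
  moreover have "h ** (u ** g) ** inv\<^bsub>SL2\<^esub> g ** inv\<^bsub>SL2\<^esub> u = h"
    using SL2_inv_cancel[OF assms(1)] SL2_inv_cancel[OF assms(2)]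
    by (metis matrix_mul_assoc matrix_mul_rid)
  ultimately show ?thesis
    by metis
qed

lemma inv_upper: "inv\<^bsub>SL2\<^esub> (upper b) = upper (- b)"
  and inv_lower: "inv\<^bsub>SL2\<^esub> (lower b) = lower (- b)"
  by (simp_all add: upper_def lower_def inv_SL2)

text \<open>The sum is invariant because the subgroup only permutes its terms, and at the base point only the
  coset of \<open>0\<close> contributes.\<close>

lemma inv_fun_nonpos:
  assumes n: "n \<le> 0" and R: "transversal 0 (- 2 * n) R"
  shows "inv_fun v \<pi> \<iota> p e r n = (\<Sum>b\<in>R. upper_fun n b)"
proof (rule inv_fun_eqI)
  let ?t = "\<pi> powi n"
  show "(\<Sum>b\<in>R. upper_fun n b) \<in> Ind"
    by (intro sum_in_Ind upper_fun_in_Ind)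
  show "translate g (\<Sum>b\<in>R. upper_fun n b) = (\<Sum>b\<in>R. upper_fun n b)" if g: "g \<in> IS1 v" for g
  proof -
    obtain a b c d where abcd: "g = mat2 a b c d"
      by (rule mat2_cases)
    have "translate g (\<Sum>b\<in>R. upper_fun n b) = (\<Sum>x\<in>R. upper_fun n ((a * x + b) / (c * x + d)))"
      unfolding translate_sum using translate_upper_fun[OF g[unfolded abcd] n] transversal_subset[OF R]
      by (intro sum.cong) (auto simp: abcd)
    also have "\<dots> = (\<Sum>b\<in>R. upper_fun n b)"
      using g R periodic_upper_fun
      by (intro sum_transversal_moebius[where m = 0]) (simp_all add: abcd IS1_mat2)
    finally show ?thesis .
  qed
  show "\<exists>k\<in>K0 v. \<exists>g\<in>IS1 v. x = k ** diag (\<pi> powi (- n)) ** g"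
    if x: "(\<Sum>b\<in>R. upper_fun n b) x \<noteq> 0" for x
  proof -
    obtain b where b: "b \<in> R" "upper_fun n b x \<noteq> 0"
      using x unfolding sum_fun_apply[of _ _ x] by (rule sum.not_neutral_contains_not_neutral)
    then obtain k where "k \<in> K0 v" "x = k ** diag (\<pi> powi (- n)) ** upper (- b)"
      using std_support[of "upper b" "diag ?t" vec_X x]
      by (auto simp: upper_fun_def inv_diag inv_upper powi_minus)
    moreover have "upper (- b) \<in> IS1 v"
      using b(1) transversal_subset[OF R] by (intro upper_IS1) auto
    ultimately show ?thesis
      by blast
  qed
  have "upper_fun n b (diag (\<pi> powi (- n))) = (if b \<in> val_ideal v (- 2 * n) then vec_X else 0)" for b
  proof -
    have "diag (\<pi> powi (- n)) ** (upper b ** diag ?t) = upper (?t\<^sup>2 * b)"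
      by (simp add: diag_def upper_def powi_minus power2_eq_square field_simps)
    moreover have "upper (?t\<^sup>2 * b) \<in> K0 v \<longleftrightarrow> b \<in> val_ideal v (- 2 * n)"
      using ideal_scale_iff[of "?t\<^sup>2" b 0]
      by (simp add: upper_def mem_K0 val_power val_power_int)
    ultimately show ?thesis
      by (simp add: upper_fun_def std_apply det_mul act_upper_vec_X)
  qed
  then show "(\<Sum>b\<in>R. upper_fun n b) (diag (\<pi> powi (- n))) = (if n > 0 then vec_Y else vec_X)"
    using n sum_transversal_at_zero[OF R, of vec_X] by (simp add: sum_fun_apply)
qed

lemma inv_fun_pos:
  assumes n: "n > 0" and R: "transversal 1 (2 * n) R"
  shows "inv_fun v \<pi> \<iota> p e r n = (\<Sum>c\<in>R. lower_fun n c)"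
proof (rule inv_fun_eqI)
  let ?t = "\<pi> powi n"
  show "(\<Sum>c\<in>R. lower_fun n c) \<in> Ind"
    by (intro sum_in_Ind lower_fun_in_Ind)
  show "translate g (\<Sum>c\<in>R. lower_fun n c) = (\<Sum>c\<in>R. lower_fun n c)" if g: "g \<in> IS1 v" for g
  proof -
    obtain a b c d where abcd: "g = mat2 a b c d"
      by (rule mat2_cases)
    have "translate g (\<Sum>c\<in>R. lower_fun n c) = (\<Sum>x\<in>R. lower_fun n ((d * x + c) / (b * x + a)))"
      unfolding translate_sum using translate_lower_fun[OF g[unfolded abcd] n] transversal_subset[OF R]
      by (intro sum.cong) (auto simp: abcd)
    also have "\<dots> = (\<Sum>c\<in>R. lower_fun n c)"
      using g R periodic_lower_fun
      by (intro sum_transversal_moebius[where m = 1]) (simp_all add: abcd IS1_mat2 mult.commute)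
    finally show ?thesis .
  qed
  show "\<exists>k\<in>K0 v. \<exists>g\<in>IS1 v. x = k ** diag (\<pi> powi (- n)) ** g"
    if x: "(\<Sum>c\<in>R. lower_fun n c) x \<noteq> 0" for x
  proof -
    obtain c where c: "c \<in> R" "lower_fun n c x \<noteq> 0"
      using x unfolding sum_fun_apply[of _ _ x] by (rule sum.not_neutral_contains_not_neutral)
    then obtain k where "k \<in> K0 v" "x = k ** diag (\<pi> powi (- n)) ** lower (- c)"
      using std_support[of "lower c" "diag ?t" vec_Y x]
      by (auto simp: lower_fun_def inv_diag inv_lower powi_minus)
    moreover have "lower (- c) \<in> IS1 v"
      using c(1) transversal_subset[OF R] by (intro lower_IS1) auto
    ultimately show ?thesis
      by blast
  qed
  have "lower_fun n c (diag (\<pi> powi (- n))) = (if c \<in> val_ideal v (2 * n) then vec_Y else 0)" for c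
  proof -
    have "diag (\<pi> powi (- n)) ** (lower c ** diag ?t) = lower (inverse (?t\<^sup>2) * c)"
      by (simp add: diag_def lower_def powi_minus power2_eq_square field_simps)
    moreover have "lower (inverse (?t\<^sup>2) * c) \<in> K0 v \<longleftrightarrow> c \<in> val_ideal v (2 * n)"
      using ideal_scale_iff[of "inverse (?t\<^sup>2)" c 0]
      by (simp add: lower_def mem_K0 val_inverse val_power val_power_int)
    ultimately show ?thesis
      by (simp add: lower_fun_def std_apply det_mul act_lower_vec_Y)
  qed
  then show "(\<Sum>c\<in>R. lower_fun n c) (diag (\<pi> powi (- n))) = (if n > 0 then vec_Y else vec_X)"
    using n sum_transversal_at_zero[OF R, of vec_Y] by (simp add: sum_fun_apply)
qed

end


section \<open>The Hecke operator on invariant functions\<close>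

context weight_setting
begin

text \<open>A summand that is constant on larger cosets than those represented takes each value a multiple
  of \<open>q\<close> times, and \<open>q = 0\<close> in the coefficients.\<close>

lemma sum_transversal_vanishes:
  fixes F :: "'f \<Rightarrow> ('f, 'k) ifun"
  assumes R: "transversal a (b + 1) R" and F: "periodic a b F" and "a \<le> b"
  shows "sum F R = 0"
proof -
  obtain S where S: "transversal a b S"
    using transversal_exists[OF \<open>a \<le> b\<close>] .
  obtain T where T: "transversal b (b + 1) T"
    using transversal_exists[of b "b + 1"] by auto
  have "sum F R = (\<Sum>x\<in>S. \<Sum>y\<in>T. F (x + y))"
    by (rule sum_transversal_add[OF S T R \<open>a \<le> b\<close> _ periodic_mono[OF F], symmetric]) simp_all
  also have "\<dots> = (\<Sum>x\<in>S. \<Sum>y\<in>T. F x)"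
  proof (intro sum.cong refl)
    fix x y assume "x \<in> S" "y \<in> T"
    then have x: "x \<in> val_ideal v a" and y: "y \<in> val_ideal v b"
      using transversal_subset[OF S] transversal_subset[OF T] by auto
    show "F (x + y) = F x"
      using ideal_add[OF x ideal_mono[OF y \<open>a \<le> b\<close>]] x y by (intro periodicD[OF F]) auto
  qed
  also have "\<dots> = 0"
    by (simp only: sum_const_ifun[where S = T] card_transversal_Suc[OF T] of_nat_q scale_zero sum.neutral_const)
  finally show ?thesis .
qed

end

locale hecke_operator = weight_setting v \<pi> \<iota> p e r
  for v :: "'f::field \<Rightarrow> int" and \<pi> and \<iota> :: "'f set \<Rightarrow> 'k::field" and p e r +
  fixes \<tau> :: "('f, 'k) ifun \<Rightarrow> ('f, 'k) ifun"
  assumes hecke: "is_hecke_op v \<pi> \<iota> p e r \<tau>"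
begin

abbreviation inv_f :: "int \<Rightarrow> ('f, 'k) ifun" where
  "inv_f \<equiv> inv_fun v \<pi> \<iota> p e r"

definition digits1 :: "'f set" where
  "digits1 = teich_sum v \<pi> ` digit_lists 1"

definition digits2 :: "'f set" where
  "digits2 = teich_sum v \<pi> ` digit_lists 2"

lemma transversal_digits1: "transversal 0 1 digits1"
  and transversal_digits2: "transversal 0 2 digits2"
  using transversal_teich_sum[of 1] transversal_teich_sum[of 2]
  by (simp_all add: digits1_def digits2_def)

lemma tau_zero: "\<tau> 0 = 0"
proof -
  have "\<tau> (scale 0 0) = scale 0 (\<tau> 0)"
    using hecke zero_in_Ind unfolding is_hecke_op_def by blast
  then show ?thesis
    by (simp only: scale_zero)
qed

lemma tau_sum:
  assumes "\<And>i. i \<in> S \<Longrightarrow> f i \<in> Ind"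
  shows "\<tau> (\<Sum>i\<in>S. f i) = (\<Sum>i\<in>S. \<tau> (f i))"
  using assms
proof (induction S rule: infinite_finite_induct)
  case (insert i S)
  have "(\<Sum>i\<in>S. f i) \<in> Ind" "f i \<in> Ind"
    using insert.prems by (auto intro!: sum_in_Ind)
  then have "\<tau> (f i + (\<Sum>i\<in>S. f i)) = \<tau> (f i) + \<tau> (\<Sum>i\<in>S. f i)"
    using hecke unfolding is_hecke_op_def by blast
  moreover have "\<tau> (\<Sum>i\<in>S. f i) = (\<Sum>i\<in>S. \<tau> (f i))"
    using insert by blast
  ultimately show ?case
    by (simp only: sum.insert[OF insert.hyps(1,2)])
qed (simp_all only: sum.empty sum.infinite not_False_eq_True tau_zero)

lemma tau_std:
  assumes "det g = 1" "x \<in> weight e r"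
  shows "\<tau> (std g x) =
    (\<Sum>A\<in>digits2. std (g ** upper A ** diag (inverse \<pi>))
      (act w0 (U_op e r (act (mat2 0 1 (- 1) A) x)))) +
    (\<Sum>B\<in>digits1. std (g ** lower (\<pi> * B) ** diag \<pi>) (U_op e r x))"
proof -
  have lists1: "digit_lists 1 = (\<lambda>c. [c]) ` carrier (residue_field v)"
    by (auto simp: digit_lists_def length_Suc_conv)
  have "\<tau> (std g x) =
      (\<Sum>ls\<in>digit_lists 2. std (g ** upper (teich_sum v \<pi> ls) ** diag (inverse \<pi>))
        (act w0 (U_op e r (act (mat2 0 1 (- 1) (teich_sum v \<pi> ls)) x)))) +
      (\<Sum>c\<in>carrier (residue_field v). std (g ** lower (\<pi> * teich_sum v \<pi> [c]) ** diag \<pi>) (U_op e r x))"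
    using hecke assms
    by (simp add: is_hecke_op_def digit_lists_def alpha0_diag inv_diag upper_def lower_def)
  also have "(\<Sum>c\<in>carrier (residue_field v). std (g ** lower (\<pi> * teich_sum v \<pi> [c]) ** diag \<pi>) (U_op e r x)) =
      (\<Sum>B\<in>digits1. std (g ** lower (\<pi> * B) ** diag \<pi>) (U_op e r x))"
    unfolding digits1_def sum.reindex[OF inj_on_teich_sum] unfolding lists1
    by (simp add: sum.reindex inj_on_def)
  also have "(\<Sum>ls\<in>digit_lists 2. std (g ** upper (teich_sum v \<pi> ls) ** diag (inverse \<pi>))
        (act w0 (U_op e r (act (mat2 0 1 (- 1) (teich_sum v \<pi> ls)) x)))) =
      (\<Sum>A\<in>digits2. std (g ** upper A ** diag (inverse \<pi>))
        (act w0 (U_op e r (act (mat2 0 1 (- 1) A) x))))"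
    unfolding digits2_def by (simp add: sum.reindex[OF inj_on_teich_sum])
  finally show ?thesis .
qed

lemma powi_add_1: "\<pi> powi (n + 1) = \<pi> powi n * \<pi>"
  and powi_diff_1: "\<pi> powi (n - 1) = \<pi> powi n * inverse \<pi>"
  by (simp_all add: power_int_add power_int_diff divide_inverse)

lemma std_cong_K0:
  assumes "g = h ** k" "det h = 1" "k \<in> K0 v" "act k x = y"
  shows "std g x = std h y"
  using std_mult_K0[OF assms(2,3), of x] assms(1,4) by simp

text \<open>One step ahead: a unipotent factor passes through the diagonal element and merges with the one in
  front of it.\<close>

lemma first_sum_upper:
  "std (upper b ** diag (\<pi> powi n) ** upper A ** diag (inverse \<pi>)) vec_X =
    upper_fun (n - 1) (b + A / (\<pi> powi n)\<^sup>2)"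
proof -
  have "diag (\<pi> powi n) ** upper A = upper (A / (\<pi> powi n)\<^sup>2) ** diag (\<pi> powi n)"
    by (simp add: diag_upper)
  then have "upper b ** diag (\<pi> powi n) ** upper A ** diag (inverse \<pi>) =
      upper b ** (upper (A / (\<pi> powi n)\<^sup>2) ** diag (\<pi> powi n)) ** diag (inverse \<pi>)"
    by (metis matrix_mul_assoc)
  also have "\<dots> = upper (b + A / (\<pi> powi n)\<^sup>2) ** diag (\<pi> powi (n - 1))"
    unfolding powi_diff_1 upper_add[symmetric] diag_mult[symmetric] matrix_mul_assoc ..
  finally show ?thesis
    by (simp only: upper_fun_def)
qed

lemma second_sum_lower:
  "std (lower c ** diag (\<pi> powi n) ** lower B ** diag \<pi>) vec_Y =
    lower_fun (n + 1) (c + B * (\<pi> powi n)\<^sup>2)"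
proof -
  have "diag (\<pi> powi n) ** lower B = lower (B * (\<pi> powi n)\<^sup>2) ** diag (\<pi> powi n)"
    by (simp add: diag_lower)
  then have "lower c ** diag (\<pi> powi n) ** lower B ** diag \<pi> =
      lower c ** (lower (B * (\<pi> powi n)\<^sup>2) ** diag (\<pi> powi n)) ** diag \<pi>"
    by (metis matrix_mul_assoc)
  also have "\<dots> = lower (c + B * (\<pi> powi n)\<^sup>2) ** diag (\<pi> powi (n + 1))"
    unfolding powi_add_1 lower_add[symmetric] diag_mult[symmetric] matrix_mul_assoc ..
  finally show ?thesis
    by (simp only: lower_fun_def)
qed

text \<open>For the trivial weight the second family never advances \<open>upper_fun\<close>: a digit in \<open>\<p>\<close> leads one
  step back, and a unit digit stays at the same level.\<close>

lemma second_sum_upper_back: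
  assumes r: "\<forall>i<e. r i = 0" and B: "B \<in> val_ideal v 1"
  shows "std (upper b ** diag (\<pi> powi n) ** lower (\<pi> * B) ** diag \<pi>) vec_Y = upper_fun (n + 1) b"
  unfolding upper_fun_def
proof (rule std_cong_K0)
  have "\<pi> * (B / \<pi>) \<in> val_ideal v 1"
    using B by simp
  then show "lower (B / \<pi>) \<in> K0 v"
    by (intro lower_K0) (simp only: ideal_scale_iff[OF uniformizer_nonzero], simp)
  have "lower (\<pi> * B) ** diag \<pi> = diag \<pi> ** lower (B / \<pi>)"
    by (simp add: diag_def lower_def)
  then show "upper b ** diag (\<pi> powi n) ** lower (\<pi> * B) ** diag \<pi> =
      upper b ** diag (\<pi> powi (n + 1)) ** lower (B / \<pi>)"
    unfolding powi_add_1 diag_mult[symmetric] by (metis matrix_mul_assoc)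
  show "act (lower (B / \<pi>)) vec_Y = vec_X"
    by (simp add: act_lower_vec_Y vec_X_eq_vec_Y[OF r])
qed (simp add: det_mul)

lemma second_sum_upper_unit:
  assumes r: "\<forall>i<e. r i = 0" and B: "B \<in> val_ideal v 0" "B \<notin> val_ideal v 1"
  shows "std (upper b ** diag (\<pi> powi n) ** lower (\<pi> * B) ** diag \<pi>) vec_Y =
    upper_fun n (b + inverse (\<pi> * B) / (\<pi> powi n)\<^sup>2)"
  unfolding upper_fun_def
proof (rule std_cong_K0)
  let ?k = "mat2 0 (- inverse B) B \<pi>"
  have B0: "B \<noteq> 0" "v B = 0"
    using unit_val B by auto
  show "?k \<in> K0 v"
    using B0 B by (simp add: mem_K0 in_ideal_iff val_inverse)
  have "lower (\<pi> * B) ** diag \<pi> = upper (inverse (\<pi> * B)) ** ?k"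
    using B0 by (simp add: diag_def lower_def upper_def)
  moreover have "diag (\<pi> powi n) ** upper (inverse (\<pi> * B)) =
      upper (inverse (\<pi> * B) / (\<pi> powi n)\<^sup>2) ** diag (\<pi> powi n)"
    by (simp add: diag_upper)
  ultimately show "upper b ** diag (\<pi> powi n) ** lower (\<pi> * B) ** diag \<pi> =
      upper (b + inverse (\<pi> * B) / (\<pi> powi n)\<^sup>2) ** diag (\<pi> powi n) ** ?k"
    unfolding upper_add[symmetric] by (metis matrix_mul_assoc)
  show "act ?k vec_Y = vec_X"
    using act_vec_X_antidiagonal[of ?k]
    by (simp add: vec_X_eq_vec_Y[OF r, symmetric] chi_trivial[OF r])
qed (simp add: det_mul)

text \<open>In the first family a unit digit \<open>A\<close> leads one step ahead, into the cosets that the second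
  family leaves out. The scalar \<open>\<chi>r (- A)\<close> is exactly compensated.\<close>

lemma first_sum_lower_unit:
  assumes A: "A \<in> val_ideal v 0" "A \<notin> val_ideal v 1"
  shows "std (lower c ** diag (\<pi> powi n) ** upper A ** diag (inverse \<pi>)) (\<lambda>l. \<chi>r (- A) * vec_X l) =
    lower_fun (n + 1) (c + inverse A * (\<pi> powi n)\<^sup>2)"
  unfolding lower_fun_def
proof (rule std_cong_K0)
  let ?k = "mat2 (\<pi>\<^sup>2) A (- inverse A) 0"
  have A0: "A \<noteq> 0" "v A = 0"
    using unit_val A by auto
  have iA: "inverse A \<in> val_ideal v 0"
    using A0 by (simp add: in_ideal_iff val_inverse)
  show "?k \<in> K0 v"
    using A0 A iA by (simp add: mem_K0 in_ideal_iff val_power)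
  have eq1: "upper A ** diag (inverse \<pi>) = lower (inverse A) ** (diag \<pi> ** ?k)"
    using A0 by (simp add: diag_def lower_def upper_def power2_eq_square)
  have eq2: "diag (\<pi> powi n) ** (lower (inverse A) ** Z) =
      lower (inverse A * (\<pi> powi n)\<^sup>2) ** (diag (\<pi> powi n) ** Z)" for Z
    by (simp add: matrix_mul_assoc diag_lower)
  show "lower c ** diag (\<pi> powi n) ** upper A ** diag (inverse \<pi>) =
      lower (c + inverse A * (\<pi> powi n)\<^sup>2) ** diag (\<pi> powi (n + 1)) ** ?k"
    unfolding lower_add[symmetric] powi_add_1 diag_mult[symmetric]
    by (simp only: matrix_mul_assoc[symmetric] eq1 eq2)
  have "\<chi>r (- A) * \<chi>r (- inverse A) = 1"
    using chi_mult[of "- A" "- inverse A"] A iA A0 by simp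
  moreover have "act ?k vec_X = (\<lambda>l. \<chi>r (- inverse A) * vec_Y l)"
    using act_vec_X_antidiagonal[of ?k] by (simp add: in_ideal_iff val_power)
  ultimately show "act ?k (\<lambda>l. \<chi>r (- A) * vec_X l) = vec_Y"
    by (simp add: act_scale mult.assoc[symmetric])
qed (simp add: det_mul)

text \<open>For the trivial weight the remaining digits of the first family lead a step back or stay at the
  same level.\<close>

lemma first_sum_lower_back:
  assumes r: "\<forall>i<e. r i = 0" and A: "A \<in> val_ideal v 2"
  shows "std (lower c ** diag (\<pi> powi n) ** upper A ** diag (inverse \<pi>)) vec_X = lower_fun (n - 1) c"
  unfolding lower_fun_def
proof (rule std_cong_K0)
  have "\<pi>\<^sup>2 * (A / \<pi>\<^sup>2) \<in> val_ideal v 2"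
    using A by simp
  then show "upper (A / \<pi>\<^sup>2) \<in> K0 v"
    using ideal_scale_iff[of "\<pi>\<^sup>2" "A / \<pi>\<^sup>2" 2] by (intro upper_K0) (simp add: val_power)
  have "upper A ** diag (inverse \<pi>) = diag (inverse \<pi>) ** upper (A / \<pi>\<^sup>2)"
    by (simp add: diag_def upper_def power2_eq_square) (rule divide_inverse[symmetric])
  then show "lower c ** diag (\<pi> powi n) ** upper A ** diag (inverse \<pi>) =
      lower c ** diag (\<pi> powi (n - 1)) ** upper (A / \<pi>\<^sup>2)"
    unfolding powi_diff_1 diag_mult[symmetric] by (metis matrix_mul_assoc)
  show "act (upper (A / \<pi>\<^sup>2)) vec_X = vec_Y"
    by (simp add: act_upper_vec_X vec_X_eq_vec_Y[OF r, symmetric])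
qed (simp add: det_mul)

lemma first_sum_lower_stay:
  assumes r: "\<forall>i<e. r i = 0" and A: "A \<in> val_ideal v 1" "A \<notin> val_ideal v 2"
  shows "std (lower c ** diag (\<pi> powi n) ** upper A ** diag (inverse \<pi>)) vec_X =
    lower_fun n (c + inverse A * (\<pi> powi n)\<^sup>2)"
  unfolding lower_fun_def
proof (rule std_cong_K0)
  let ?k = "mat2 \<pi> (A / \<pi>) (- \<pi> / A) 0"
  have A0: "A \<noteq> 0" "v A = 1"
    using A by (auto simp: val_ideal_def)
  show "?k \<in> K0 v"
    using A0 by (simp add: mem_K0 in_ideal_iff val_divide)
  have "upper A ** diag (inverse \<pi>) = lower (inverse A) ** ?k"
    using A0 by (simp add: diag_def lower_def upper_def) (simp add: divide_inverse)
  moreover have "diag (\<pi> powi n) ** lower (inverse A) =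
      lower (inverse A * (\<pi> powi n)\<^sup>2) ** diag (\<pi> powi n)"
    by (simp add: diag_lower)
  ultimately show "lower c ** diag (\<pi> powi n) ** upper A ** diag (inverse \<pi>) =
      lower (c + inverse A * (\<pi> powi n)\<^sup>2) ** diag (\<pi> powi n) ** ?k"
    unfolding lower_add[symmetric] by (metis matrix_mul_assoc)
  show "act ?k vec_X = vec_Y"
    using act_vec_X_antidiagonal[of ?k] by (simp add: in_ideal_iff chi_trivial[OF r])
qed (simp add: det_mul)

lemma tau_upper_fun:
  "\<tau> (upper_fun n b) = (\<Sum>A\<in>digits2. upper_fun (n - 1) (b + A / (\<pi> powi n)\<^sup>2)) +
    (if \<forall>i<e. r i = 0 then
      \<Sum>B\<in>digits1. std (upper b ** diag (\<pi> powi n) ** lower (\<pi> * B) ** diag \<pi>) vec_Y else 0)"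
proof -
  have "\<tau> (upper_fun n b) = (\<Sum>A\<in>digits2. upper_fun (n - 1) (b + A / (\<pi> powi n)\<^sup>2)) +
    (\<Sum>B\<in>digits1. std (upper b ** diag (\<pi> powi n) ** lower (\<pi> * B) ** diag \<pi>) (U_op e r vec_X))"
    unfolding upper_fun_def[of n]
    by (subst tau_std) (simp_all only: det_mul det_upper det_diag powi_nonzero mult_1_left simp_thms
        vec_X_in_weight hecke_coeff_vec_X first_sum_upper)
  note main = this
  show ?thesis
  proof (cases "\<forall>i<e. r i = 0")
    case True
    show ?thesis
      using main unfolding U_vec_X if_P[OF True] .
  next
    case False
    show ?thesis
      using main unfolding U_vec_X if_not_P[OF False] std_zero sum.neutral_const .
  qed
qed

lemma tau_lower_fun:
  "\<tau> (lower_fun n c) =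
    (\<Sum>A\<in>digits2. std (lower c ** diag (\<pi> powi n) ** upper A ** diag (inverse \<pi>)) (\<lambda>l. \<chi>r (- A) * vec_X l)) +
    (\<Sum>B\<in>digits1. lower_fun (n + 1) (c + \<pi> * B * (\<pi> powi n)\<^sup>2))"
proof -
  have "act w0 (U_op e r (act (mat2 0 1 (- 1) A) vec_Y)) = (\<lambda>l. \<chi>r (- A) * vec_X l)"
    if "A \<in> digits2" for A
    using that transversal_subset[OF transversal_digits2] by (intro hecke_coeff_vec_Y) blast
  then show ?thesis
    unfolding lower_fun_def[of n]
    by (subst tau_std) (simp_all add: det_mul U_vec_Y second_sum_lower)
qed

text \<open>The two digits of the first family refine each coset of the old level into the cosets of the new
  one.\<close>

lemma sum_first_upper:
  assumes n: "n \<le> 0" and R: "transversal 0 (- 2 * n) R"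
  shows "(\<Sum>b\<in>R. \<Sum>A\<in>digits2. upper_fun (n - 1) (b + A / (\<pi> powi n)\<^sup>2)) = inv_f (n - 1)"
proof -
  let ?s = "inverse ((\<pi> powi n)\<^sup>2)"
  have vs: "v ?s = - 2 * n"
    by (simp add: val_inverse val_power val_power_int)
  let ?S = "(*) ?s ` digits2"
  have S: "transversal (- 2 * n) (- 2 * (n - 1)) ?S"
    using transversal_scale[OF transversal_digits2, of ?s] vs by (simp add: add.commute)
  obtain T where T: "transversal 0 (- 2 * (n - 1)) T"
    using transversal_exists[of 0 "- 2 * (n - 1)"] n by auto
  have "(\<Sum>b\<in>R. \<Sum>A\<in>digits2. upper_fun (n - 1) (b + A / (\<pi> powi n)\<^sup>2)) =
      (\<Sum>b\<in>R. \<Sum>A\<in>?S. upper_fun (n - 1) (b + A))"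
    by (simp add: sum.reindex inj_on_def field_simps)
  also have "\<dots> = (\<Sum>b\<in>T. upper_fun (n - 1) b)"
    using n by (intro sum_transversal_add[OF R S T _ _ periodic_upper_fun]) auto
  also have "\<dots> = inv_f (n - 1)"
    using n T by (simp add: inv_fun_nonpos)
  finally show ?thesis .
qed

lemma tau_inv_fun_0:
  "\<tau> (inv_f 0) = inv_f (- 1) + scale (if \<forall>i<e. r i = 0 then 1 else 0) (inv_f 1)"
proof -
  have R: "transversal 0 (- 2 * 0) {0}"
    using transversal_singleton by simp
  \<comment> \<open>At level \<open>0\<close> the second family leaves the vertex of \<open>K\<^sub>0\<close> into the lower unipotent cosets.\<close>
  have "upper 0 ** diag (\<pi> powi 0) ** lower (\<pi> * B) ** diag \<pi> = lower (\<pi> * B) ** diag (\<pi> powi 1)" for B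
    by (simp add: upper_def lower_def diag_def)
  moreover have "(\<Sum>B\<in>digits1. lower_fun 1 (\<pi> * B)) = inv_f 1"
  proof -
    have "transversal 1 (2 * 1) ((*) \<pi> ` digits1)"
      using transversal_scale[OF transversal_digits1, of \<pi>] by simp
    then have "inv_f 1 = (\<Sum>c\<in>(*) \<pi> ` digits1. lower_fun 1 c)"
      by (rule inv_fun_pos[OF zero_less_one])
    then show ?thesis
      by (simp add: sum.reindex inj_on_def)
  qed
  ultimately have "(\<Sum>B\<in>digits1. std (upper 0 ** diag (\<pi> powi 0) ** lower (\<pi> * B) ** diag \<pi>) vec_Y) = inv_f 1"
    by (simp only: lower_fun_def)
  moreover have "(\<Sum>A\<in>digits2. upper_fun (0 - 1) (0 + A / (\<pi> powi 0)\<^sup>2)) = inv_f (- 1)"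
    using sum_first_upper[OF _ R] by simp
  moreover have "inv_f 0 = upper_fun 0 0"
    using inv_fun_nonpos[OF _ R] by simp
  ultimately show ?thesis
    using tau_upper_fun[of 0 0] by auto
qed

lemma tau_inv_fun_neg:
  assumes n: "n < 0"
  shows "\<tau> (inv_f n) =
    scale (if \<forall>i<e. r i = 0 then of_nat (q - 1) else 0) (inv_f n) + inv_f (n - 1)"
proof -
  obtain R where R: "transversal 0 (- 2 * n) R"
    using transversal_exists[of 0 "- 2 * n"] n by auto
  have f_n: "inv_f n = (\<Sum>b\<in>R. upper_fun n b)"
    using n R by (simp add: inv_fun_nonpos)
  let ?second = "\<lambda>b B. std (upper b ** diag (\<pi> powi n) ** lower (\<pi> * B) ** diag \<pi>) vec_Y"
  have second: "(\<Sum>b\<in>R. ?second b B) = (if B \<in> val_ideal v 1 then 0 else inv_f n)"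
    if r: "\<forall>i<e. r i = 0" and "B \<in> digits1" for B
  proof -
    have B: "B \<in> val_ideal v 0"
      using that transversal_subset[OF transversal_digits1] by blast
    show ?thesis
    proof (cases "B \<in> val_ideal v 1")
      case True
      \<comment> \<open>The summand even has period \<open>- 2 * n - 2\<close>; one digit less than \<open>R\<close> yields a factor \<open>q\<close>.\<close>
      have "periodic 0 (- 2 * n - 1) (upper_fun (n + 1))"
        by (rule periodic_mono[OF periodic_upper_fun]) simp
      then have "(\<Sum>b\<in>R. upper_fun (n + 1) b) = 0"
        using sum_transversal_vanishes[of 0 "- 2 * n - 1" R] R n by simp
      with True show ?thesis
        by (simp add: second_sum_upper_back[OF r])
    next
      case False
      let ?t = "inverse (\<pi> * B) / (\<pi> powi n)\<^sup>2"
      have "B \<noteq> 0" "v B = 0"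
        using unit_val[OF B False] by auto
      then have "?t \<in> val_ideal v 0"
        using n by (simp add: in_ideal_iff val_divide val_inverse val_mult val_power val_power_int)
      then have "(\<Sum>b\<in>R. upper_fun n (b + ?t)) = inv_f n"
        unfolding f_n by (rule sum_transversal_translate[OF R periodic_upper_fun])
      with False show ?thesis
        by (simp add: second_sum_upper_unit[OF r B])
    qed
  qed
  have "(\<Sum>b\<in>R. \<Sum>B\<in>digits1. ?second b B) = scale (of_nat (q - 1)) (inv_f n)"
    if r: "\<forall>i<e. r i = 0"
  proof -
    have "(\<Sum>b\<in>R. \<Sum>B\<in>digits1. ?second b B) =
        (\<Sum>B\<in>digits1. if B \<in> val_ideal v 1 then 0 else inv_f n)"
      by (subst sum.swap) (intro sum.cong refl second[OF r])
    also have "\<dots> = (\<Sum>B\<in>{x \<in> digits1. x \<notin> val_ideal v 1}. inv_f n)"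
      using transversal_finite[OF transversal_digits1] by (simp only: sum.inter_filter if_not_P cong: if_cong)
        (auto intro!: sum.cong)
    also have "\<dots> = scale (of_nat (q - 1)) (inv_f n)"
      unfolding sum_const_ifun using card_transversal_nonzero[of 0 digits1] transversal_digits1 by simp
    finally show ?thesis .
  qed
  moreover have "\<tau> (inv_f n) = (\<Sum>b\<in>R. \<tau> (upper_fun n b))"
    unfolding f_n by (rule tau_sum[OF upper_fun_in_Ind])
  moreover have "(\<Sum>b\<in>R. \<Sum>A\<in>digits2. upper_fun (n - 1) (b + A / (\<pi> powi n)\<^sup>2)) = inv_f (n - 1)"
    using n by (intro sum_first_upper R) simp
  ultimately show ?thesis
    unfolding tau_upper_fun sum.distrib by (cases "\<forall>i<e. r i = 0") (auto simp: add.commute)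
qed

text \<open>Inversion is an isometry of the units, so the unit digits of the first family account for the
  units modulo \<open>\<p>\<^sup>2\<close>, and the digits of the second family for the rest.\<close>

lemma transversal_inverse_digits:
  "transversal 0 2 (inverse ` {A \<in> digits2. A \<notin> val_ideal v 1} \<union> (*) \<pi> ` digits1)"
    (is "transversal 0 2 (?U \<union> ?P)")
proof -
  have D2: "A \<in> val_ideal v 0" if "A \<in> digits2" for A
    using that transversal_subset[OF transversal_digits2] by blast
  have P: "transversal 1 2 ?P"
    using transversal_scale[OF transversal_digits1, of \<pi>] by simp
  have inv_diff: "inverse x - inverse y \<in> val_ideal v 2 \<longleftrightarrow> x - y \<in> val_ideal v 2"
    if "x \<noteq> 0" "v x = 0" "y \<noteq> 0" "v y = 0" for x y
  proof -
    have "inverse x - inverse y = (- inverse (x * y)) * (x - y)"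
      using that by (simp add: field_simps)
    then show ?thesis
      using ideal_scale_iff[of "- inverse (x * y)" "x - y" 2] that
      by (simp add: val_inverse val_mult)
  qed
  have U: "u \<noteq> 0 \<and> v u = 0 \<and> inverse u \<in> digits2" if "u \<in> ?U" for u
    using that unit_val D2 by (auto simp: val_inverse)
  have disjoint: "u - w \<notin> val_ideal v 2" if "u \<in> ?U" "w \<in> ?P" for u w
  proof
    assume "u - w \<in> val_ideal v 2"
    then have "u - w + w \<in> val_ideal v 1"
      using that transversal_subset[OF P] ideal_mono[of "u - w" 2 1] by (intro ideal_add) auto
    then show False
      using U[OF that(1)] by (simp add: in_ideal_iff)
  qed
  show ?thesis
  proof (rule transversalI)
    show "finite (?U \<union> ?P)"
      using transversal_finite[OF transversal_digits1] transversal_finite[OF transversal_digits2]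
      by simp
    show "?U \<union> ?P \<subseteq> val_ideal v 0"
    proof
      fix x assume "x \<in> ?U \<union> ?P"
      then show "x \<in> val_ideal v 0"
      proof
        assume "x \<in> ?U"
        from U[OF this] show ?thesis
          by (simp add: in_ideal_iff)
      next
        assume "x \<in> ?P"
        then have "x \<in> val_ideal v 1"
          using transversal_subset[OF P] by blast
        then show ?thesis
          by (rule ideal_mono) simp
      qed
    qed
  next
    fix x assume x: "x \<in> val_ideal v 0"
    show "\<exists>y\<in>?U \<union> ?P. x - y \<in> val_ideal v 2"
    proof (cases "x \<in> val_ideal v 1")
      case True
      obtain y where "y \<in> ?P" "x - y \<in> val_ideal v 2"
        using transversal_ex[OF P True] .
      then show ?thesis
        by blast
    next
      case False
      then have x': "x \<noteq> 0" "v x = 0"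
        using unit_val[OF x] by auto
      then have ix: "inverse x \<in> val_ideal v 0"
        by (simp add: in_ideal_iff val_inverse)
      obtain A where A: "A \<in> digits2" "inverse x - A \<in> val_ideal v 2"
        using transversal_ex[OF transversal_digits2 ix] .
      have "A \<notin> val_ideal v 1"
        using ideal_add[OF ideal_mono[OF A(2), of 1], of A] x' by (auto simp: in_ideal_iff val_inverse)
      moreover from this have "A \<noteq> 0" "v A = 0"
        using unit_val[OF D2[OF A(1)]] by auto
      ultimately show ?thesis
        using inv_diff[of "inverse x" A] A x' by (intro bexI[of _ "inverse A"]) (auto simp: val_inverse)
    qed
  next
    fix x y assume xy: "x \<in> ?U \<union> ?P" "y \<in> ?U \<union> ?P" "x - y \<in> val_ideal v 2"
    then consider "x \<in> ?U" "y \<in> ?U" | "x \<in> ?P" "y \<in> ?P"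
      using disjoint[of x y] disjoint[of y x] ideal_diff_commute[of x y 2] by blast
    then show "x = y"
    proof cases
      case 1
      then have "inverse x - inverse y \<in> val_ideal v 2"
        using U xy(3) inv_diff by blast
      then show ?thesis
        using transversal_eqI[OF transversal_digits2, of "inverse x" "inverse y"] U 1 by auto
    next
      case 2
      then show ?thesis
        using transversal_eqI[OF P] xy(3) by blast
    qed
  qed
qed

lemma tau_inv_fun_pos:
  assumes n: "n > 0"
  shows "\<tau> (inv_f n) =
    scale (if \<forall>i<e. r i = 0 then of_nat (q - 1) else 0) (inv_f n) + inv_f (n + 1)"
proof -
  let ?s = "(\<pi> powi n)\<^sup>2"
  have s: "?s \<noteq> 0" "v ?s = 2 * n"
    by (simp_all add: val_power val_power_int)
  obtain R where R: "transversal 1 (2 * n) R"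
    using transversal_exists[of 1 "2 * n"] n by auto
  have f_n: "inv_f n = (\<Sum>c\<in>R. lower_fun n c)"
    using n R by (rule inv_fun_pos)
  let ?first = "\<lambda>c A. std (lower c ** diag (\<pi> powi n) ** upper A ** diag (inverse \<pi>)) (\<lambda>l. \<chi>r (- A) * vec_X l)"
  let ?next = "\<lambda>y. \<Sum>c\<in>R. lower_fun (n + 1) (c + y * ?s)"
  let ?c = "if \<forall>i<e. r i = 0 then of_nat (q - 1) else 0 :: 'k"
  let ?U = "{A \<in> digits2. A \<notin> val_ideal v 1}" and ?M = "digits2 \<inter> val_ideal v 1"
  have M: "transversal 1 2 ?M"
    by (rule transversal_restrict[OF transversal_digits2]) simp_all
  \<comment> \<open>The digits of the first family that do not advance.\<close>
  have first_max: "(\<Sum>c\<in>R. ?first c A) =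
      (if A \<in> val_ideal v 2 then 0 else scale (if \<forall>i<e. r i = 0 then 1 else 0) (inv_f n))"
    if A: "A \<in> ?M" for A
  proof (cases "\<forall>i<e. r i = 0")
    case False
    have "\<chi>r (- A) = 0"
      using A by (intro chi_maximal_ideal[OF _ False]) simp
    then have "(\<lambda>l. \<chi>r (- A) * vec_X l) = (0 :: 'k wt)"
      by (simp add: zero_fun_def)
    then show ?thesis
      by (simp only: std_zero sum.neutral_const if_not_P[OF False] scale_zero if_cancel)
  next
    case True
    have chi: "(\<lambda>l. \<chi>r (- A) * vec_X l) = vec_X"
      by (simp add: chi_trivial[OF True])
    show ?thesis
    proof (cases "A \<in> val_ideal v 2")
      case A2: True
      \<comment> \<open>The summand even has period \<open>2 * n - 2\<close>, but for \<open>n = 1\<close> this is coarser than \<open>\<p>\<close> itself; one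
        digit less than \<open>R\<close> yields a factor \<open>q\<close>.\<close>
      have "periodic 1 (2 * n - 1) (lower_fun (n - 1))"
        by (rule periodic_mono[OF periodic_lower_fun]) simp
      then have "(\<Sum>c\<in>R. lower_fun (n - 1) c) = 0"
        using sum_transversal_vanishes[of 1 "2 * n - 1" R] R n by simp
      with A2 show ?thesis
        by (simp add: chi first_sum_lower_back[OF True])
    next
      case A2: False
      have "A \<noteq> 0" "v A = 1"
        using A A2 by (auto simp: val_ideal_def)
      then have "inverse A * ?s \<in> val_ideal v 1"
        using n s by (simp add: in_ideal_iff val_inverse val_mult)
      then have "(\<Sum>c\<in>R. lower_fun n (c + inverse A * ?s)) = inv_f n"
        unfolding f_n by (rule sum_transversal_translate[OF R periodic_lower_fun])
      with A A2 True show ?thesis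
        by (simp add: chi first_sum_lower_stay[OF True])
    qed
  qed
  have "(\<Sum>A\<in>?M. \<Sum>c\<in>R. ?first c A) =
      (\<Sum>A\<in>{x \<in> ?M. x \<notin> val_ideal v 2}. scale (if \<forall>i<e. r i = 0 then 1 else 0) (inv_f n))"
    using transversal_finite[OF M] first_max by (intro sum.mono_neutral_cong_right) auto
  also have "\<dots> = scale ?c (inv_f n)"
  proof (cases "\<forall>i<e. r i = 0")
    case True
    have "card {x \<in> ?M. x \<notin> val_ideal v 2} = q - 1"
      using card_transversal_nonzero[of 1 ?M] M by simp
    then show ?thesis
      by (simp only: if_P[OF True] scale_one sum_const_ifun)
  next
    case False
    show ?thesis
      unfolding if_not_P[OF False] scale_zero sum.neutral_const ..
  qed
  finally have max: "(\<Sum>A\<in>?M. \<Sum>c\<in>R. ?first c A) = scale ?c (inv_f n)" .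
  have "(\<Sum>A\<in>?U. \<Sum>c\<in>R. ?first c A) = (\<Sum>A\<in>?U. ?next (inverse A))"
    using transversal_subset[OF transversal_digits2]
    by (intro sum.cong refl first_sum_lower_unit) auto
  also have "\<dots> = (\<Sum>y\<in>inverse ` ?U. ?next y)"
    by (subst sum.reindex) (simp_all add: inj_on_def)
  finally have unit: "(\<Sum>A\<in>?U. \<Sum>c\<in>R. ?first c A) = (\<Sum>y\<in>inverse ` ?U. ?next y)" .
  have second: "(\<Sum>c\<in>R. \<Sum>B\<in>digits1. lower_fun (n + 1) (c + \<pi> * B * ?s)) = (\<Sum>y\<in>(*) \<pi> ` digits1. ?next y)"
    by (subst sum.swap) (simp add: sum.reindex inj_on_def)
  let ?D = "inverse ` ?U \<union> (*) \<pi> ` digits1"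
  have "inverse ` ?U \<inter> (*) \<pi> ` digits1 = {}"
  proof -
    have "x \<notin> val_ideal v 1" if x: "x \<in> inverse ` ?U" for x
    proof -
      obtain A where A: "x = inverse A" "A \<in> digits2" "A \<notin> val_ideal v 1"
        using x by blast
      then have "A \<noteq> 0 \<and> v A = 0"
        using transversal_subset[OF transversal_digits2] by (intro unit_val) auto
      then show ?thesis
        by (simp add: A(1) in_ideal_iff val_inverse)
    qed
    moreover have "x \<in> val_ideal v 1" if "x \<in> (*) \<pi> ` digits1" for x
      using that transversal_subset[OF transversal_digits1] by (auto simp: ideal_scale_iff)
    ultimately show ?thesis
      by blast
  qed
  then have "(\<Sum>y\<in>inverse ` ?U. ?next y) + (\<Sum>y\<in>(*) \<pi> ` digits1. ?next y) = (\<Sum>y\<in>?D. ?next y)"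
    using transversal_finite[OF transversal_inverse_digits] by (intro sum.union_disjoint[symmetric]) auto
  also have "\<dots> = (\<Sum>c\<in>R. \<Sum>y\<in>(*) ?s ` ?D. lower_fun (n + 1) (c + y))"
    by (subst sum.swap) (simp add: sum.reindex inj_on_def mult.commute)
  also have "\<dots> = inv_f (n + 1)"
  proof -
    have S: "transversal (2 * n) (2 * (n + 1)) ((*) ?s ` ?D)"
      using transversal_scale[OF transversal_inverse_digits s(1)] s(2) by (simp add: add.commute)
    obtain T where T: "transversal 1 (2 * (n + 1)) T"
      using transversal_exists[of 1 "2 * (n + 1)"] n by auto
    have "(\<Sum>c\<in>R. \<Sum>y\<in>(*) ?s ` ?D. lower_fun (n + 1) (c + y)) = (\<Sum>c\<in>T. lower_fun (n + 1) c)"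
      using n by (intro sum_transversal_add[OF R S T _ _ periodic_lower_fun]) auto
    then show ?thesis
      using n T by (simp add: inv_fun_pos)
  qed
  finally have next_sum: "(\<Sum>y\<in>inverse ` ?U. ?next y) + (\<Sum>y\<in>(*) \<pi> ` digits1. ?next y) = inv_f (n + 1)" .
  have "\<tau> (inv_f n) = (\<Sum>c\<in>R. \<tau> (lower_fun n c))"
    unfolding f_n by (rule tau_sum[OF lower_fun_in_Ind])
  also have "\<dots> = (\<Sum>A\<in>digits2. \<Sum>c\<in>R. ?first c A) + (\<Sum>y\<in>(*) \<pi> ` digits1. ?next y)"
    unfolding tau_lower_fun sum.distrib second by (subst sum.swap) simp
  also have "(\<Sum>A\<in>digits2. \<Sum>c\<in>R. ?first c A) = (\<Sum>A\<in>?M. \<Sum>c\<in>R. ?first c A) + (\<Sum>A\<in>?U. \<Sum>c\<in>R. ?first c A)"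
    using transversal_finite[OF transversal_digits2]
    by (subst sum.union_disjoint[symmetric]) (auto intro!: sum.cong)
  finally show ?thesis
    unfolding max unit next_sum[symmetric] by (simp only: add.assoc)
qed

end

theorem lemma4p6:
  fixes v :: "'f::field \<Rightarrow> int" and \<pi> :: 'f
    and \<iota> :: "'f set \<Rightarrow> 'k::alg_closed_field"
    and p e :: nat and r :: "nat \<Rightarrow> nat"
    and \<tau> :: "('f, 'k) ifun \<Rightarrow> ('f, 'k) ifun"
  assumes "nonarch_local_field v"
    and "Factorial_Ring.prime p" and "card (carrier (residue_field v)) = p ^ e"
    and "uniformizer v \<pi>"
    and "is_Fp_closure TYPE('k) p"
    and "\<iota> \<in> ring_hom (residue_field v) (ring_of_type_algebra :: 'k ring)"
    and "\<forall>i<e. r i \<le> p - 1"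
    and "is_hecke_op v \<pi> \<iota> p e r \<tau>"
  shows "\<tau> (inv_fun v \<pi> \<iota> p e r 0) =
           inv_fun v \<pi> \<iota> p e r (- 1) +
           scale (if \<forall>i<e. r i = 0 then 1 else 0) (inv_fun v \<pi> \<iota> p e r 1) \<and>
         (\<forall>n::int. n \<noteq> 0 \<longrightarrow>
           (\<exists>c::'k. \<tau> (inv_fun v \<pi> \<iota> p e r n) =
              scale c (inv_fun v \<pi> \<iota> p e r n) +
              inv_fun v \<pi> \<iota> p e r (n + (if n > 0 then 1 else - 1))))"
proof -
  interpret hecke_operator v \<pi> \<iota> p e r \<tau>
    by unfold_locales
      (use assms in \<open>simp_all add: nonarch_local_field_def is_Fp_closure_def\<close>)
  show ?thesis
  proof (intro conjI allI impI)
    show "\<tau> (inv_f 0) = inv_f (- 1) + scale (if \<forall>i<e. r i = 0 then 1 else 0) (inv_f 1)"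
      by (rule tau_inv_fun_0)
    fix n :: int assume "n \<noteq> 0"
    then consider "n > 0" | "n < 0"
      by linarith
    then show "\<exists>c. \<tau> (inv_f n) = scale c (inv_f n) + inv_f (n + (if n > 0 then 1 else - 1))"
    proof cases
      case 1
      then show ?thesis
        using tau_inv_fun_pos[OF 1] by (intro exI) simp
    next
      case 2
      then show ?thesis
        using tau_inv_fun_neg[OF 2] by (intro exI) simp
    qed
  qed
qed

end
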